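(* Let $\mathbb F$ be any field of characteristic $5$. The algebra $\hat{\mathcal H}$ over $\mathbb F$ is a primitive $2$-generated symmetric axial algebra of Monster type $(2,\frac12)$ (with generating axes $\hat a_0,\hat a_1$).
   Context: **Axial algebras of Monster type.** Algebras are commutative, not necessarily associative, over a field $\mathbb F$ (here of characteristic $5$, so $\frac12=-2=3$). Let $\alpha,\beta\in\mathbb F\setminus\{0,1\}$ with $\alpha\ne\beta$. The Monster fusion law of type $(\alpha,\beta)$ is the symmetric map $\star$ from pairs in $\{1,0,\alpha,\beta\}$ to subsets of $\{1,0,\alpha,\beta\}$ given by $1\star1=\{1\}$, $1\star0=\emptyset$, $1\star\alpha=\{\alpha\}$, $1\star\beta=\{\beta\}$, $0\star0=\{0\}$, $0\star\alpha=\{\alpha\}$, $0\star\beta=\{\beta\}$, $\alpha\star\alpha=\{1,0\}$, $\alpha\star\beta=\{\beta\}$, $\beta\star\beta=\{1,0,\alpha\}$. For an algebra $V$ and $a\in V$ let $\mathrm{ad}_a:x\mapsto ax$, and let $V_\mu^a$ be the $\mu$-eigenspace of $\mathrm{ad}_a$. A primitive axis of Monster type $(\alpha,\beta)$ is a nonzero idempotent $a$ such that $V=V_1^a\oplus V_0^a\oplus V_\alpha^a\oplus V_\beta^a$, $V_\mu^aV_\nu^a\subseteq\bigoplus_{\kappa\in\mu\star\nu}V_\kappa^a$ for all $\mu,\nu\in\{1,0,\alpha,\beta\}$, and $V_1^a=\mathbb Fa$. A primitive $2$-generated axial algebra of Monster type $(\alpha,\beta)$ is an algebra $V$ generated (as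 an algebra) by two primitive axes $a_0,a_1$ of Monster type $(\alpha,\beta)$; it is symmetric if there is an algebra automorphism $f$ of $V$ swapping $a_0$ and $a_1$. **The algebra $\hat{\mathcal H}$.** For an integer $i$ let $\bar\imath=i+3\mathbb Z$; let $\mathbb Z_+$ be the positive integers. $\hat{\mathcal H}$ is the $\mathbb F$-vector space with basis $\{\hat a_i,\ \hat s_{\bar0,j},\ \hat s_{\bar1,3k},\ \hat s_{\bar2,3k}\mid i\in\mathbb Z,\ j,k\in\mathbb Z_+\}$. Set $\hat s_{\bar r,0}:=0$ for all $\bar r$, and $\hat s_{\bar1,j}:=\hat s_{\bar0,j}=:\hat s_{\bar2,j}$ if $j\in\mathbb Z_+$, $3\nmid j$. Write $\delta$ for the Kronecker delta, and set $(-1)\ast\bar1:=-1$, $(-1)\ast\bar2:=1$, $0\ast\bar t:=0$ for all $\bar t$. The product is commutative and bilinear with (for indices $i,j$ of $\hat a$ in $\mathbb Z$, second indices of $\hat s$ in the factors on the left in $\mathbb Z_+$, and $h,k\in\mathbb Z_+$): 1. $\hat a_i\hat a_j=-2(\hat a_i+\hat a_j)+\hat s_{\bar\imath,|i-j|}$; 2. $\hat a_i\hat s_{\bar r,j}=-2\hat a_i+(\hat a_{i-j}+\hat a_{i+j})-\hat s_{\bar r,j}-\big((\delta_{\bar\imath\,\bar r}-1)\ast(\bar\imath-\bar r)\big)(\hat s_{\bar r-\bar1,j}-\hat s_{\bar r+\bar1,j})$; 3. $\hat s_{\bar r,i}\hat s_{\bar t,j}=2(\hat s_{\bar r,i}+\hat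 s_{\bar t,j})-2(\hat s_{\bar0,|i-j|}+\hat s_{\bar1,|i-j|}+\hat s_{\bar2,|i-j|}+\hat s_{\bar0,i+j}+\hat s_{\bar1,i+j}+\hat s_{\bar2,i+j})$ if $\{i,j\}\not\subseteq3\mathbb Z$; 4. $\hat s_{\bar r,3h}\hat s_{\bar r,3k}=2(\hat s_{\bar r,3h}+\hat s_{\bar r,3k})-(\hat s_{\bar r,3|h-k|}+\hat s_{\bar r,3(h+k)})$ for $\bar r\in\{\bar0,\bar1,\bar2\}$; 5. $\hat s_{\bar r,3h}\hat s_{\bar t,3k}=2(y_h+y_k)-(y_{|h-k|}+y_{h+k})$ for $\{\bar r,\bar t,\bar q\}=\{\bar0,\bar1,\bar2\}$ (three distinct classes), where $y_m:=\hat s_{\bar r,3m}+\hat s_{\bar t,3m}-\hat s_{\bar q,3m}$. *)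

theory Defs
  imports
    Complex_Main
    "HOL-Library.Poly_Mapping"
    "HOL-Library.Numeral_Type"
begin

text \<open>As {1, 0, \<alpha>, \<beta>} are pairwise distinct wherever the law is used, comparing unordered pairs
  of eigenvalues determines the symmetric table; other arguments are irrelevant.\<close>

definition monster_law :: "'k::field \<Rightarrow> 'k \<Rightarrow> 'k \<Rightarrow> 'k \<Rightarrow> 'k set" where
  "monster_law \<alpha> \<beta> \<mu> \<nu> =
     (if {\<mu>, \<nu>} = {1} then {1}
      else if {\<mu>, \<nu>} = {1, 0} then {}
      else if {\<mu>, \<nu>} = {1, \<alpha>} then {\<alpha>}
      else if {\<mu>, \<nu>} = {1, \<beta>} then {\<beta>}
      else if {\<mu>, \<nu>} = {0} then {0}
      else if {\<mu>, \<nu>} = {0, \<alpha>} then {\<alpha>}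
      else if {\<mu>, \<nu>} = {0, \<beta>} then {\<beta>}
      else if {\<mu>, \<nu>} = {\<alpha>} then {1, 0}
      else if {\<mu>, \<nu>} = {\<alpha>, \<beta>} then {\<beta>}
      else if {\<mu>, \<nu>} = {\<beta>} then {1, 0, \<alpha>}
      else {})"

locale comm_nonassoc_algebra = vector_space scale
  for scale :: "'k::field \<Rightarrow> 'v::ab_group_add \<Rightarrow> 'v"  (infixr \<open>*s\<close> 75) +
  fixes mult :: "'v \<Rightarrow> 'v \<Rightarrow> 'v"  (infixl \<open>\<cdot>\<close> 70)
  assumes mult_commute: "x \<cdot> y = y \<cdot> x"
    and mult_add_left: "(x + y) \<cdot> z = x \<cdot> z + y \<cdot> z"
    and mult_scale_left: "(c *s x) \<cdot> y = c *s (x \<cdot> y)"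
begin

definition subalgebra :: "'v set \<Rightarrow> bool" where
  "subalgebra W \<longleftrightarrow> subspace W \<and> (\<forall>x\<in>W. \<forall>y\<in>W. x \<cdot> y \<in> W)"

definition automorphism :: "('v \<Rightarrow> 'v) \<Rightarrow> bool" where
  "automorphism f \<longleftrightarrow> Vector_Spaces.linear scale scale f \<and> bij f \<and> (\<forall>x y. f (x \<cdot> y) = f x \<cdot> f y)"

definition eigenspace :: "'v \<Rightarrow> 'k \<Rightarrow> 'v set" where
  "eigenspace a \<mu> = {x. a \<cdot> x = \<mu> *s x}"

definition eigensum :: "'v \<Rightarrow> 'k set \<Rightarrow> 'v set" where
  "eigensum a S = {\<Sum>\<kappa>\<in>S. x \<kappa> | x. \<forall>\<kappa>\<in>S. x \<kappa> \<in> eigenspace a \<kappa>}"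

definition eigensum_direct :: "'v \<Rightarrow> 'k set \<Rightarrow> bool" where
  "eigensum_direct a S \<longleftrightarrow>
     (\<forall>x. (\<forall>\<kappa>\<in>S. x \<kappa> \<in> eigenspace a \<kappa>) \<longrightarrow> (\<Sum>\<kappa>\<in>S. x \<kappa>) = 0 \<longrightarrow> (\<forall>\<kappa>\<in>S. x \<kappa> = 0))"

definition primitive_monster_axis :: "'k \<Rightarrow> 'k \<Rightarrow> 'v \<Rightarrow> bool" where
  "primitive_monster_axis \<alpha> \<beta> a \<longleftrightarrow>
     a \<noteq> 0 \<and> a \<cdot> a = a \<and>
     eigensum a {1, 0, \<alpha>, \<beta>} = UNIV \<and> eigensum_direct a {1, 0, \<alpha>, \<beta>} \<and>
     (\<forall>\<mu>\<in>{1, 0, \<alpha>, \<beta>}. \<forall>\<nu>\<in>{1, 0, \<alpha>, \<beta>}. \<forall>x\<in>eigenspace a \<mu>. \<forall>y\<in>eigenspace a \<nu>.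
        x \<cdot> y \<in> eigensum a (monster_law \<alpha> \<beta> \<mu> \<nu>)) \<and>
     eigenspace a 1 = span {a}"

end

locale two_generated_monster_algebra = comm_nonassoc_algebra scale mult
  for scale :: "'k::field \<Rightarrow> 'v::ab_group_add \<Rightarrow> 'v"  (infixr \<open>*s\<close> 75)
    and mult :: "'v \<Rightarrow> 'v \<Rightarrow> 'v"  (infixl \<open>\<cdot>\<close> 70) +
  fixes \<alpha> \<beta> :: 'k and a0 a1 :: 'v
  assumes type_params: "\<alpha> \<notin> {0, 1}" "\<beta> \<notin> {0, 1}" "\<alpha> \<noteq> \<beta>"
    and axes: "primitive_monster_axis \<alpha> \<beta> a0" "primitive_monster_axis \<alpha> \<beta> a1"
    and generated: "subalgebra hull {a0, a1} = UNIV"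

locale symmetric_two_generated_monster_algebra = two_generated_monster_algebra +
  assumes symmetric: "\<exists>f. automorphism f \<and> f a0 = a1 \<and> f a1 = a0"


text \<open>The numeral type \<^typ>\<open>3\<close> is the ring of integers modulo 3, with \<^const>\<open>of_int\<close> as the
  residue map.  The algebra \<open>H\<close> (with a hat) has basis \<open>a\<^sub>i\<close> (i an integer), \<open>s\<^sub>0\<^sub>,\<^sub>j\<close>,
  \<open>s\<^sub>1\<^sub>,\<^sub>3\<^sub>k\<close>, \<open>s\<^sub>2\<^sub>,\<^sub>3\<^sub>k\<close> (j, k positive).  The functions \<open>ha\<close> and \<open>hs\<close> give these elements,
  where \<open>hs\<close> follows the conventions \<open>s\<^sub>r\<^sub>,\<^sub>0 = 0\<close> and \<open>s\<^sub>r\<^sub>,\<^sub>j = s\<^sub>0\<^sub>,\<^sub>j\<close> for j not divisible by 3.\<close>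

typedef s_index = "{(r :: 3, j :: nat). 0 < j \<and> (r = 0 \<or> 3 dvd j)}"
  by (rule exI[of _ "(0, 1)"]) simp

datatype h_basis = Ax int | Sx s_index

type_synonym 'k h_alg = "h_basis \<Rightarrow>\<^sub>0 'k"

definition h_scale :: "'k::field \<Rightarrow> 'k h_alg \<Rightarrow> 'k h_alg"  (infixr \<open>*\<^sub>h\<close> 75) where
  "c *\<^sub>h x = Poly_Mapping.map ((*) c) x"

definition ha :: "int \<Rightarrow> 'k::field h_alg" where
  "ha i = Poly_Mapping.single (Ax i) 1"

definition hs :: "3 \<Rightarrow> nat \<Rightarrow> 'k::field h_alg" where
  "hs r j =
     (if j = 0 then 0
      else if 3 dvd j then Poly_Mapping.single (Sx (Abs_s_index (r, j))) 1
      else Poly_Mapping.single (Sx (Abs_s_index (0, j))) 1)"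

text \<open>Only the arguments \<open>c = 0\<close> and \<open>c = -1, t \<noteq> 0\<close> occur.\<close>

definition h_star :: "int \<Rightarrow> 3 \<Rightarrow> 'k::field" where
  "h_star c t = (if c = -1 \<and> t = 1 then -1 else if c = -1 \<and> t = 2 then 1 else 0)"

definition prod_aa :: "int \<Rightarrow> int \<Rightarrow> 'k::field h_alg" where
  "prod_aa i j = (-2) *\<^sub>h (ha i + ha j) + hs (of_int i) (nat \<bar>i - j\<bar>)"

definition prod_as :: "int \<Rightarrow> 3 \<Rightarrow> nat \<Rightarrow> 'k::field h_alg" where
  "prod_as i r j =
     (-2) *\<^sub>h ha i + (ha (i - int j) + ha (i + int j)) - hs r j
     - h_star (of_bool (of_int i = r) - 1) (of_int i - r) *\<^sub>h (hs (r - 1) j - hs (r + 1) j)"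

definition hy :: "3 \<Rightarrow> 3 \<Rightarrow> 3 \<Rightarrow> nat \<Rightarrow> 'k::field h_alg" where
  "hy r t q m = hs r (3 * m) + hs t (3 * m) - hs q (3 * m)"

text \<open>For distinct \<open>r\<close> and \<open>t\<close> in \<open>\<int>/3\<int>\<close> the third class is \<open>- r - t\<close>, as \<open>0 + 1 + 2 = 0\<close>.\<close>

definition prod_ss :: "3 \<Rightarrow> nat \<Rightarrow> 3 \<Rightarrow> nat \<Rightarrow> 'k::field h_alg" where
  "prod_ss r i t j =
     (let d = nat \<bar>int i - int j\<bar> in
      if \<not> (3 dvd i \<and> 3 dvd j) then
        2 *\<^sub>h (hs r i + hs t j)
        - 2 *\<^sub>h (hs 0 d + hs 1 d + hs 2 d + hs 0 (i + j) + hs 1 (i + j) + hs 2 (i + j))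
      else if r = t then
        2 *\<^sub>h (hs r i + hs r j) - (hs r d + hs r (i + j))
      else
        (let y = hy r t (- r - t); h = i div 3; k = j div 3 in
         2 *\<^sub>h (y h + y k) - (y (nat \<bar>int h - int k\<bar>) + y (h + k))))"

fun basis_prod :: "h_basis \<Rightarrow> h_basis \<Rightarrow> 'k::field h_alg" where
  "basis_prod (Ax i) (Ax j) = prod_aa i j"
| "basis_prod (Ax i) (Sx u) = (case Rep_s_index u of (r, j) \<Rightarrow> prod_as i r j)"
| "basis_prod (Sx u) (Ax i) = (case Rep_s_index u of (r, j) \<Rightarrow> prod_as i r j)"
| "basis_prod (Sx u) (Sx v) =
     (case Rep_s_index u of (r, i) \<Rightarrow> case Rep_s_index v of (t, j) \<Rightarrow> prod_ss r i t j)"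

definition h_mult :: "'k::field h_alg \<Rightarrow> 'k h_alg \<Rightarrow> 'k h_alg"  (infixl \<open>\<cdot>\<^sub>h\<close> 70) where
  "x \<cdot>\<^sub>h y =
     (\<Sum>b\<in>Poly_Mapping.keys x. \<Sum>c\<in>Poly_Mapping.keys y.
        (Poly_Mapping.lookup x b * Poly_Mapping.lookup y c) *\<^sub>h basis_prod b c)"

text \<open>The defining relations of the product, for all admissible indices.  They also show that
  \<open>basis_prod\<close> does not depend on the representative \<open>hs 0 j\<close> chosen for \<open>hs r j\<close> when
  \<open>3\<close> does not divide \<open>j\<close>.\<close>

lemma lookup_h_scale [simp]:
  "Poly_Mapping.lookup (c *\<^sub>h x) b = c * Poly_Mapping.lookup x b"
  unfolding h_scale_def by (simp add: map.rep_eq when_def)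

lemma h_scale_one [simp]: "1 *\<^sub>h x = x"
  by (rule poly_mapping_eqI) simp

lemma h_scale_zero [simp]: "c *\<^sub>h 0 = 0"
  by (rule poly_mapping_eqI) simp

lemma h_mult_single:
  "Poly_Mapping.single b 1 \<cdot>\<^sub>h Poly_Mapping.single c 1 = basis_prod b c"
  by (simp add: h_mult_def)

lemma hs_nondvd: "\<not> 3 dvd j \<Longrightarrow> hs r j = hs 0 j"
  by (simp add: hs_def)

lemma hs_basis:
  assumes "0 < j"
  obtains r' u where "hs r j = Poly_Mapping.single (Sx u) 1" "Rep_s_index u = (r', j)"
    "hs r j = (hs r' j :: 'k::field h_alg)" "3 dvd j \<Longrightarrow> r' = r"
proof (cases "3 dvd j")
  case True
  then show ?thesis
    using assms that[of "Abs_s_index (r, j)" r] by (simp add: hs_def Abs_s_index_inverse)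
next
  case False
  then show ?thesis
    using assms that[of "Abs_s_index (0, j)" 0] by (simp add: hs_def Abs_s_index_inverse)
qed

lemma ha_mult_ha:
  "(ha i :: 'k::field h_alg) \<cdot>\<^sub>h ha j = (-2) *\<^sub>h (ha i + ha j) + hs (of_int i) (nat \<bar>i - j\<bar>)"
  by (simp add: ha_def[where i = i] ha_def[where i = j] h_mult_single prod_aa_def)

lemma ha_mult_hs:
  assumes "0 < j"
  shows "(ha i :: 'k::field h_alg) \<cdot>\<^sub>h hs r j =
     (-2) *\<^sub>h ha i + (ha (i - int j) + ha (i + int j)) - hs r j
     - h_star (of_bool (of_int i = r) - 1) (of_int i - r) *\<^sub>h (hs (r - 1) j - hs (r + 1) j)"
proof -
  obtain r' u where u: "hs r j = (Poly_Mapping.single (Sx u) 1 :: 'k h_alg)"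
    "Rep_s_index u = (r', j)" "hs r j = (hs r' j :: 'k h_alg)" "3 dvd j \<Longrightarrow> r' = r"
    using assms by (rule hs_basis[where r = r]) blast
  have "(ha i :: 'k h_alg) \<cdot>\<^sub>h hs r j = prod_as i r' j"
    by (simp add: u(1,2) ha_def h_mult_single)
  also have "\<dots> = prod_as i r j"
  proof (cases "3 dvd j")
    case False
    then show ?thesis
      by (simp add: prod_as_def hs_nondvd[of j "_ + _"] hs_nondvd[of j "_ - _"] u(3)[symmetric])
  qed (simp add: u(4))
  finally show ?thesis by (simp add: prod_as_def)
qed

lemma hs_mult_hs:
  assumes "0 < i" "0 < j" "\<not> (3 dvd i \<and> 3 dvd j)"
  defines "d \<equiv> nat \<bar>int i - int j\<bar>"
  shows "(hs r i :: 'k::field h_alg) \<cdot>\<^sub>h hs t j =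
     2 *\<^sub>h (hs r i + hs t j)
     - 2 *\<^sub>h (hs 0 d + hs 1 d + hs 2 d + hs 0 (i + j) + hs 1 (i + j) + hs 2 (i + j))"
proof -
  obtain r' u where u: "hs r i = (Poly_Mapping.single (Sx u) 1 :: 'k h_alg)"
    "Rep_s_index u = (r', i)" "hs r i = (hs r' i :: 'k h_alg)"
    using assms(1) by (rule hs_basis[where r = r]) blast
  obtain t' v where v: "hs t j = (Poly_Mapping.single (Sx v) 1 :: 'k h_alg)"
    "Rep_s_index v = (t', j)" "hs t j = (hs t' j :: 'k h_alg)"
    using assms(2) by (rule hs_basis[where r = t]) blast
  have "(hs r i :: 'k h_alg) \<cdot>\<^sub>h hs t j = prod_ss r' i t' j"
    by (simp add: u(1,2) v(1,2) h_mult_single)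
  then show ?thesis
    unfolding prod_ss_def Let_def d_def using assms(3) by (simp only: u(3) v(3) if_True not_False_eq_True)
qed

lemma hs_mult_hs_dvd:
  assumes "0 < h" "0 < k"
  shows "(hs r (3 * h) :: 'k::field h_alg) \<cdot>\<^sub>h hs t (3 * k) = prod_ss r (3 * h) t (3 * k)"
proof -
  have "0 < 3 * h" "0 < 3 * k" using assms by simp_all
  obtain r' u where u: "hs r (3 * h) = (Poly_Mapping.single (Sx u) 1 :: 'k h_alg)"
    "Rep_s_index u = (r', 3 * h)" "3 dvd 3 * h \<Longrightarrow> r' = r"
    using \<open>0 < 3 * h\<close> by (rule hs_basis[where r = r]) blast
  obtain t' v where v: "hs t (3 * k) = (Poly_Mapping.single (Sx v) 1 :: 'k h_alg)"
    "Rep_s_index v = (t', 3 * k)" "3 dvd 3 * k \<Longrightarrow> t' = t"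
    using \<open>0 < 3 * k\<close> by (rule hs_basis[where r = t]) blast
  show ?thesis
    using u(3) v(3) by (simp add: u(1,2) v(1,2) h_mult_single)
qed

lemma hs_mult_hs_same:
  assumes "0 < h" "0 < k"
  shows "(hs r (3 * h) :: 'k::field h_alg) \<cdot>\<^sub>h hs r (3 * k) =
     2 *\<^sub>h (hs r (3 * h) + hs r (3 * k))
     - (hs r (3 * nat \<bar>int h - int k\<bar>) + hs r (3 * (h + k)))"
proof -
  have "nat \<bar>int (3 * h) - int (3 * k)\<bar> = 3 * nat \<bar>int h - int k\<bar>"
    by linarith
  then show ?thesis
    unfolding hs_mult_hs_dvd[OF assms] prod_ss_def Let_def
    by (simp only: dvd_triv_left simp_thms if_False if_True distrib_left[symmetric])
qed

lemma hs_mult_hs_distinct: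
  assumes "0 < h" "0 < k" "{r, t, q} = (UNIV :: 3 set)"
  defines "y \<equiv> hy r t q :: nat \<Rightarrow> 'k::field h_alg"
  shows "hs r (3 * h) \<cdot>\<^sub>h hs t (3 * k) = 2 *\<^sub>h (y h + y k) - (y (nat \<bar>int h - int k\<bar>) + y (h + k))"
proof -
  have univ: "(UNIV :: 3 set) = {0, 1, 2}"
  proof -
    have "card {0, 1, 2 :: 3} = CARD(3)" by simp
    then show ?thesis by (metis card_subset_eq finite subset_UNIV)
  qed
  have "card {r, t, q} = 3" using assms(3) by simp
  then have "r \<noteq> t" "r \<noteq> q" "t \<noteq> q" by (auto simp: card_insert_if split: if_splits)
  moreover have "r \<in> {0, 1, 2}" "t \<in> {0, 1, 2}" "q \<in> {0, 1, 2}" using univ by blast+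
  ultimately have "q = - r - t" "r \<noteq> t" by auto
  then show ?thesis
    unfolding hs_mult_hs_dvd[OF assms(1,2)] prod_ss_def Let_def y_def by simp
qed

end

theory Submission
  imports Defs
begin

text \<open>If the second index of \<open>s\<close> is extended to all integers by \<open>s\<^sub>r\<^sub>,\<^sub>-\<^sub>j = s\<^sub>r\<^sub>,\<^sub>j\<close>, the product
  rules become uniform (at index \<open>0\<close> some of them need \<open>5 = 0\<close>), and every reflection
  \<open>a\<^sub>i \<mapsto> a\<^sub>c\<^sub>-\<^sub>i\<close>, \<open>s\<^sub>r\<^sub>,\<^sub>j \<mapsto> s\<^sub>c\<^sub>-\<^sub>r\<^sub>,\<^sub>j\<close> is an automorphism.  Reflection with \<open>c = 1\<close> swaps the two generators,
  so only \<open>a\<^sub>0\<close> has to be shown to be an axis.  Put \<open>A\<^sub>j = a\<^sub>j + a\<^sub>-\<^sub>j\<close>.  The algebra is spanned by the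
  eigenvectors \<open>a\<^sub>0\<close> (for 1), \<open>u\<^sub>j = A\<^sub>j + 2s\<^sub>0\<^sub>,\<^sub>j - 2a\<^sub>0\<close> and \<open>z\<^sub>j = s\<^sub>1\<^sub>,\<^sub>j + s\<^sub>2\<^sub>,\<^sub>j - 2s\<^sub>0\<^sub>,\<^sub>j\<close> (for 0),
  \<open>v\<^sub>j = A\<^sub>j - s\<^sub>0\<^sub>,\<^sub>j - 2a\<^sub>0\<close> (for 2), and \<open>a\<^sub>j - a\<^sub>-\<^sub>j\<close>, \<open>s\<^sub>1\<^sub>,\<^sub>j - s\<^sub>2\<^sub>,\<^sub>j\<close> (for 3 = 1/2).  The last eigenspace is
  the (-1)-eigenspace of the reflection with \<open>c = 0\<close> and the others make up its fixed space, which
  gives all fusion rules involving 1/2.  The remaining ones follow from the products of the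
  \<open>u\<^sub>j\<close>, \<open>z\<^sub>j\<close>, \<open>v\<^sub>j\<close>.\<close>

subsection \<open>Commutative nonassociative algebras\<close>

context comm_nonassoc_algebra
begin

lemma mult_add_right: "x \<cdot> (y + z) = x \<cdot> y + x \<cdot> z"
  by (metis mult_add_left mult_commute)

lemma mult_scale_right: "x \<cdot> (c *s y) = c *s (x \<cdot> y)"
  by (metis mult_scale_left mult_commute)

lemma linear_mult_right: "Vector_Spaces.linear scale scale (\<lambda>y. x \<cdot> y)"
  by unfold_locales (simp_all add: mult_add_right mult_scale_right)

lemma mult_zero_right [simp]: "x \<cdot> 0 = 0"
  by (metis mult_scale_right scale_zero_left)

lemma mult_zero_left [simp]: "0 \<cdot> x = 0"
  by (metis mult_zero_right mult_commute)

lemma mult_minus_right: "x \<cdot> (- y) = - (x \<cdot> y)"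
  by (metis mult_scale_right scale_minus_left scale_one)

lemma mult_minus_left: "(- x) \<cdot> y = - (x \<cdot> y)"
  by (metis mult_minus_right mult_commute)

lemma mult_diff_right: "x \<cdot> (y - z) = x \<cdot> y - x \<cdot> z"
  by (metis mult_add_right mult_minus_right diff_conv_add_uminus)

lemma mult_diff_left: "(x - y) \<cdot> z = x \<cdot> z - y \<cdot> z"
  by (metis mult_diff_right mult_commute)

text \<open>By bilinearity a product of two spans need only be checked on generators; this reduces
  each fusion rule to products of explicit eigenvectors.\<close>

lemma span_mult_induct:
  assumes "subspace W" and "\<And>a b. a \<in> A \<Longrightarrow> b \<in> B \<Longrightarrow> a \<cdot> b \<in> W"
    and x: "x \<in> span A" and y: "y \<in> span B"
  shows "x \<cdot> y \<in> W"
proof -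
  have *: "a \<cdot> y \<in> W" if a: "a \<in> A" for a
    using y
  proof (induction rule: span_induct)
    case base
    show ?case
      using assms(1) by (auto simp: subspace_def mult_add_right mult_scale_right)
  next
    case (step b)
    then show ?case using assms(2) a by blast
  qed
  show ?thesis
    using x
  proof (induction rule: span_induct)
    case base
    show ?case
      using assms(1) by (auto simp: subspace_def mult_add_left mult_scale_left)
  qed (rule *)
qed

section \<open>Eigenspaces and their sums\<close>

lemma subspace_eigenspace: "subspace (eigenspace a \<mu>)"
  by (auto simp: subspace_def eigenspace_def mult_add_right mult_scale_right
      scale_right_distrib mult.commute)

lemma subspace_eigensum: "subspace (eigensum a S)"
proof (rule subspaceI)
  show "0 \<in> eigensum a S"
    unfolding eigensum_def
    by (rule CollectI, rule exI[of _ "\<lambda>_. 0"]) (simp add: subspace_0 subspace_eigenspace)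
next
  fix x y assume "x \<in> eigensum a S" "y \<in> eigensum a S"
  then obtain f g where "x = (\<Sum>\<kappa>\<in>S. f \<kappa>)" "y = (\<Sum>\<kappa>\<in>S. g \<kappa>)"
    and "\<forall>\<kappa>\<in>S. f \<kappa> \<in> eigenspace a \<kappa>" "\<forall>\<kappa>\<in>S. g \<kappa> \<in> eigenspace a \<kappa>"
    unfolding eigensum_def by blast
  then have "x + y = (\<Sum>\<kappa>\<in>S. f \<kappa> + g \<kappa>)" "\<forall>\<kappa>\<in>S. f \<kappa> + g \<kappa> \<in> eigenspace a \<kappa>"
    by (auto simp: sum.distrib intro: subspace_add subspace_eigenspace)
  then show "x + y \<in> eigensum a S"
    unfolding eigensum_def by (intro CollectI exI[of _ "\<lambda>\<kappa>. f \<kappa> + g \<kappa>"]) simp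
next
  fix c x assume "x \<in> eigensum a S"
  then obtain f where "x = (\<Sum>\<kappa>\<in>S. f \<kappa>)" "\<forall>\<kappa>\<in>S. f \<kappa> \<in> eigenspace a \<kappa>"
    unfolding eigensum_def by blast
  then have "c *s x = (\<Sum>\<kappa>\<in>S. c *s f \<kappa>)" "\<forall>\<kappa>\<in>S. c *s f \<kappa> \<in> eigenspace a \<kappa>"
    by (auto simp: scale_sum_right intro: subspace_scale subspace_eigenspace)
  then show "c *s x \<in> eigensum a S"
    unfolding eigensum_def by (intro CollectI exI[of _ "\<lambda>\<kappa>. c *s f \<kappa>"]) simp
qed

lemma eigenspace_subset_eigensum:
  assumes "finite S" "\<mu> \<in> S"
  shows "eigenspace a \<mu> \<subseteq> eigensum a S"
proof
  fix x assume x: "x \<in> eigenspace a \<mu>"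
  have "x = (\<Sum>\<kappa>\<in>S. if \<kappa> = \<mu> then x else 0)"
    using assms by simp
  moreover have "\<forall>\<kappa>\<in>S. (if \<kappa> = \<mu> then x else 0) \<in> eigenspace a \<kappa>"
    using x by (simp add: subspace_0 subspace_eigenspace)
  ultimately show "x \<in> eigensum a S"
    unfolding eigensum_def by blast
qed

lemma eigensum_empty [simp]: "eigensum a {} = {0}"
  by (auto simp: eigensum_def)

lemma eigensum_singleton [simp]: "eigensum a {\<mu>} = eigenspace a \<mu>"
  by (auto simp: eigensum_def)

lemma eigensum_directD:
  assumes "eigensum_direct a S" "\<forall>\<kappa>\<in>S. x \<kappa> \<in> eigenspace a \<kappa>" "(\<Sum>\<kappa>\<in>S. x \<kappa>) = 0" "\<mu> \<in> S"
  shows "x \<mu> = 0"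
  using assms unfolding eigensum_direct_def by blast

text \<open>Induction on \<open>S\<close>: multiplying a vanishing sum by \<open>a\<close> and
  subtracting \<open>\<mu>\<close> times the sum kills the \<open>\<mu>\<close> part and scales
  every other part by the nonzero factor \<open>\<kappa> - \<mu>\<close>.\<close>

lemma eigensum_direct:
  assumes "finite S"
  shows "eigensum_direct a S"
  using assms
proof (induction S rule: finite_induct)
  case empty
  then show ?case by (simp add: eigensum_direct_def)
next
  case (insert \<mu> S)
  show ?case
    unfolding eigensum_direct_def
  proof (intro allI impI)
    fix x assume x: "\<forall>\<kappa>\<in>insert \<mu> S. x \<kappa> \<in> eigenspace a \<kappa>" and 0: "(\<Sum>\<kappa>\<in>insert \<mu> S. x \<kappa>) = 0"
    interpret L: Vector_Spaces.linear scale scale "\<lambda>y. a \<cdot> y"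
      by (rule linear_mult_right)
    let ?y = "\<lambda>\<kappa>. (\<kappa> - \<mu>) *s x \<kappa>"
    have sum: "x \<mu> + (\<Sum>\<kappa>\<in>S. x \<kappa>) = 0"
      using 0 insert.hyps by simp
    have "0 = a \<cdot> (x \<mu> + (\<Sum>\<kappa>\<in>S. x \<kappa>)) - \<mu> *s (x \<mu> + (\<Sum>\<kappa>\<in>S. x \<kappa>))"
      by (simp add: sum)
    also have "\<dots> = (\<Sum>\<kappa>\<in>S. a \<cdot> x \<kappa> - \<mu> *s x \<kappa>)"
      using x by (simp add: mult_add_right scale_right_distrib L.sum scale_sum_right sum_subtractf
          eigenspace_def)
    also have "\<dots> = (\<Sum>\<kappa>\<in>S. ?y \<kappa>)"
      using x by (intro sum.cong) (auto simp: eigenspace_def scale_left_diff_distrib)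
    finally have "(\<Sum>\<kappa>\<in>S. ?y \<kappa>) = 0" by simp
    moreover have "\<forall>\<kappa>\<in>S. ?y \<kappa> \<in> eigenspace a \<kappa>"
      using x by (simp add: subspace_scale subspace_eigenspace)
    ultimately have "\<forall>\<kappa>\<in>S. ?y \<kappa> = 0"
      using eigensum_directD[OF insert.IH, where x = ?y] by blast
    then have "\<forall>\<kappa>\<in>S. x \<kappa> = 0"
      using insert.hyps(2) by (metis eq_iff_diff_eq_0 scale_eq_0_iff)
    then show "\<forall>\<kappa>\<in>insert \<mu> S. x \<kappa> = 0"
      using sum by simp
  qed
qed

text \<open>Subspaces \<open>U \<kappa>\<close> of the eigenspaces that together fill the space
  leave no room: by directness \<open>x\<close> has only one decomposition, and one with all parts
  in the \<open>U \<kappa>\<close> exists.\<close>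

lemma eigenspace_eqI:
  assumes S: "finite S" "\<mu> \<in> S"
    and U: "\<And>\<kappa>. \<kappa> \<in> S \<Longrightarrow> subspace (U \<kappa>)" "\<And>\<kappa>. \<kappa> \<in> S \<Longrightarrow> U \<kappa> \<subseteq> eigenspace a \<kappa>"
    and dec: "\<And>x. \<exists>w. (\<forall>\<kappa>\<in>S. w \<kappa> \<in> U \<kappa>) \<and> x = (\<Sum>\<kappa>\<in>S. w \<kappa>)"
  shows "eigenspace a \<mu> = U \<mu>"
proof
  show "eigenspace a \<mu> \<subseteq> U \<mu>"
  proof
    fix x assume x: "x \<in> eigenspace a \<mu>"
    obtain w where w: "\<forall>\<kappa>\<in>S. w \<kappa> \<in> U \<kappa>" "x = (\<Sum>\<kappa>\<in>S. w \<kappa>)"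
      using dec by blast
    \<comment> \<open>Difference of two decompositions of \<open>x\<close>: the one given by
      \<open>w\<close>, and \<open>x\<close> itself placed at \<open>\<mu>\<close>.\<close>
    let ?y = "\<lambda>\<kappa>. w \<kappa> - (if \<kappa> = \<mu> then x else 0)"
    have "(\<Sum>\<kappa>\<in>S. ?y \<kappa>) = 0"
      using S w(2) by (simp add: sum_subtractf)
    moreover have "\<forall>\<kappa>\<in>S. ?y \<kappa> \<in> eigenspace a \<kappa>"
      using w(1) U(2) x by (intro ballI subspace_diff subspace_eigenspace)
        (auto simp: subspace_0 subspace_eigenspace)
    ultimately have "?y \<mu> = 0"
      using eigensum_directD[OF eigensum_direct[OF S(1)], where x = ?y] S(2) by blast
    then show "x \<in> U \<mu>" using w(1) S(2) by auto
  qed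
qed (use assms in blast)

section \<open>Transport of axes along automorphisms\<close>

lemma automorphism_inv:
  assumes "automorphism f"
  shows "automorphism (inv f)"
proof -
  have lin: "Vector_Spaces.linear scale scale f" and bij: "bij f"
    and mult: "f (x \<cdot> y) = f x \<cdot> f y" for x y
    using assms by (auto simp: automorphism_def)
  interpret f: Vector_Spaces.linear scale scale f by (rule lin)
  have f_inv: "f (inv f x) = x" for x
    using bij by (simp add: bij_is_surj surj_f_inv_f)
  have inv_f: "x = y" if "f x = f y" for x y
    using bij that by (meson bij_is_inj injD)
  have "Vector_Spaces.linear scale scale (inv f)"
    by unfold_locales (rule inv_f, simp add: f_inv f.add f.scale)+
  moreover have "inv f (x \<cdot> y) = inv f x \<cdot> inv f y" for x y
    by (rule inv_f) (simp add: f_inv mult)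
  ultimately show ?thesis
    using bij by (simp add: automorphism_def bij_imp_bij_inv)
qed

lemma automorphism_eigenspace:
  assumes "automorphism f" "x \<in> eigenspace a \<mu>"
  shows "f x \<in> eigenspace (f a) \<mu>"
proof -
  interpret f: Vector_Spaces.linear scale scale f
    using assms(1) by (simp add: automorphism_def)
  have "f a \<cdot> f x = f (a \<cdot> x)"
    using assms(1) by (simp add: automorphism_def)
  then show ?thesis
    using assms(2) by (simp add: eigenspace_def f.scale)
qed

lemma automorphism_eigensum:
  assumes "automorphism f" "x \<in> eigensum a S"
  shows "f x \<in> eigensum (f a) S"
proof -
  interpret f: Vector_Spaces.linear scale scale f
    using assms(1) by (simp add: automorphism_def)
  obtain g where g: "x = (\<Sum>\<kappa>\<in>S. g \<kappa>)" "\<forall>\<kappa>\<in>S. g \<kappa> \<in> eigenspace a \<kappa>"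
    using assms(2) unfolding eigensum_def by blast
  then have "f x = (\<Sum>\<kappa>\<in>S. f (g \<kappa>))" "\<forall>\<kappa>\<in>S. f (g \<kappa>) \<in> eigenspace (f a) \<kappa>"
    using automorphism_eigenspace[OF assms(1)] by (auto simp: f.sum)
  then show ?thesis unfolding eigensum_def by (intro CollectI exI[of _ "\<lambda>\<kappa>. f (g \<kappa>)"]) simp
qed

text \<open>Eigenvectors of \<open>f a\<close> are pulled back by \<open>inv f\<close>, which is an
  automorphism too; the axis conditions are applied at \<open>a\<close> and the results pushed
  forward by \<open>f\<close>.\<close>

lemma automorphism_primitive_monster_axis:
  assumes f: "automorphism f" and a: "primitive_monster_axis \<alpha> \<beta> a"
  shows "primitive_monster_axis \<alpha> \<beta> (f a)"
proof -
  interpret f: Vector_Spaces.linear scale scale f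
    using f by (simp add: automorphism_def)
  have f_mult: "f (x \<cdot> y) = f x \<cdot> f y" for x y
    using f by (simp add: automorphism_def)
  have bij: "bij f" using f by (simp add: automorphism_def)
  have f_inv: "f (inv f x) = x" for x
    using bij by (simp add: bij_is_surj surj_f_inv_f)
  have inv_f: "inv f (f x) = x" for x
    using bij by (simp add: bij_is_inj)
  have inv: "inv f x \<in> eigenspace a \<mu>" if "x \<in> eigenspace (f a) \<mu>" for x \<mu>
    using automorphism_eigenspace[OF automorphism_inv[OF f] that] by (simp add: inv_f)
  have "f a \<noteq> 0"
    using a bij by (metis bij_is_inj f.zero injD primitive_monster_axis_def)
  moreover have "f a \<cdot> f a = f a"
    using a by (simp add: f_mult[symmetric] primitive_monster_axis_def)
  moreover have "eigensum (f a) {1, 0, \<alpha>, \<beta>} = UNIV"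
  proof -
    have "x \<in> eigensum (f a) {1, 0, \<alpha>, \<beta>}" for x
      using a automorphism_eigensum[OF f, of "inv f x" a "{1, 0, \<alpha>, \<beta>}"]
      by (simp add: f_inv primitive_monster_axis_def)
    then show ?thesis by blast
  qed
  moreover have "x \<cdot> y \<in> eigensum (f a) (monster_law \<alpha> \<beta> \<mu> \<nu>)"
    if "\<mu> \<in> {1, 0, \<alpha>, \<beta>}" "\<nu> \<in> {1, 0, \<alpha>, \<beta>}" "x \<in> eigenspace (f a) \<mu>" "y \<in> eigenspace (f a) \<nu>"
    for \<mu> \<nu> x y
  proof -
    have "inv f x \<cdot> inv f y \<in> eigensum a (monster_law \<alpha> \<beta> \<mu> \<nu>)"
      using a that(1,2) inv[OF that(3)] inv[OF that(4)] unfolding primitive_monster_axis_def by blast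
    from automorphism_eigensum[OF f this] show ?thesis by (simp add: f_mult f_inv)
  qed
  moreover have "eigenspace (f a) 1 = span {f a}"
  proof
    show "eigenspace (f a) 1 \<subseteq> span {f a}"
    proof
      fix x assume "x \<in> eigenspace (f a) 1"
      then have "inv f x \<in> span {a}"
        using a inv unfolding primitive_monster_axis_def by blast
      then obtain c where "inv f x = c *s a"
        by (auto simp: span_singleton)
      then have "x = c *s f a"
        by (metis f_inv f.scale)
      then show "x \<in> span {f a}"
        by (auto simp: span_singleton)
    qed
    show "span {f a} \<subseteq> eigenspace (f a) 1"
      by (rule span_minimal[OF _ subspace_eigenspace]) (simp add: eigenspace_def \<open>f a \<cdot> f a = f a\<close>)
  qed
  ultimately show ?thesis
    by (simp add: primitive_monster_axis_def eigensum_direct)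
qed

end

subsection \<open>Product rules and reflections\<close>

interpretation h: vector_space "h_scale :: 'k::field \<Rightarrow> 'k h_alg \<Rightarrow> 'k h_alg"
  by unfold_locales (auto intro!: poly_mapping_eqI simp: lookup_add algebra_simps)

text \<open>The product sums over supports, which vary with the arguments. Over fixed finite
  supersets the extra terms have coefficient 0, so linearity can be read off term by term.\<close>

lemma h_mult_superset:
  assumes "finite A" "finite B" "Poly_Mapping.keys x \<subseteq> A" "Poly_Mapping.keys y \<subseteq> B"
  shows "x \<cdot>\<^sub>h y =
    (\<Sum>b\<in>A. \<Sum>c\<in>B. (Poly_Mapping.lookup x b * Poly_Mapping.lookup y c) *\<^sub>h basis_prod b c)"
proof -
  have "x \<cdot>\<^sub>h y = (\<Sum>b\<in>Poly_Mapping.keys x. \<Sum>c\<in>B.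
      (Poly_Mapping.lookup x b * Poly_Mapping.lookup y c) *\<^sub>h basis_prod b c)"
    unfolding h_mult_def using assms
    by (intro sum.cong refl sum.mono_neutral_left) (auto simp: in_keys_iff)
  also have "\<dots> = (\<Sum>b\<in>A. \<Sum>c\<in>B.
      (Poly_Mapping.lookup x b * Poly_Mapping.lookup y c) *\<^sub>h basis_prod b c)"
    using assms by (intro sum.mono_neutral_left) (auto simp: in_keys_iff)
  finally show ?thesis .
qed

lemma cases_mod3:
  obtains "r = (0 :: 3)" | "r = 1" | "r = 2"
proof -
  have "card {0, 1, 2 :: 3} = CARD(3)" by simp
  then have "{0, 1, 2 :: 3} = UNIV" by (metis card_subset_eq finite subset_UNIV)
  then show thesis using that by blast
qed

lemma numerals_mod3:
  "(3 :: 3) = 0" "(4 :: 3) = 1" "- 1 = (2 :: 3)" "- 2 = (1 :: 3)" "- 3 = (0 :: 3)" "- 4 = (2 :: 3)"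
  by simp_all

lemma of_int_3_eq_0_iff: "of_int i = (0 :: 3) \<longleftrightarrow> 3 dvd i"
proof -
  have "(of_int i :: 3) = of_int (3 * (i div 3) + i mod 3)" by simp
  also have "\<dots> = of_int (i mod 3)"
    by (simp only: of_int_add of_int_mult of_int_numeral numerals_mod3(1) mult_zero_left add_0)
  finally have "(of_int i :: 3) = of_int m" if "i mod 3 = m" for m
    using that by simp
  moreover have "i mod 3 = 0 \<or> i mod 3 = 1 \<or> i mod 3 = 2" by linarith
  ultimately show ?thesis
    by (elim disjE) (fastforce simp: dvd_eq_mod_eq_0)+
qed

text \<open>Either 3 divides \<open>i - j\<close> and the classes agree, or it does not and
  \<open>hs\<close> ignores the class. This is what makes \<open>prod_aa\<close>
  commutative.\<close>

lemma hs_of_int_swap: "hs (of_int i) (nat \<bar>i - j\<bar>) = hs (of_int j) (nat \<bar>i - j\<bar>)"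
proof (cases "3 dvd i - j")
  case True
  then have "of_int (i - j) = (0 :: 3)" by (simp only: of_int_3_eq_0_iff)
  then show ?thesis by simp
next
  case False
  then have "\<not> 3 dvd nat \<bar>i - j\<bar>" by (simp add: nat_dvd_iff)
  then show ?thesis by (metis hs_nondvd)
qed

lemma prod_ss_commute: "(prod_ss r i t j :: 'a::field h_alg) = prod_ss t j r i"
proof -
  have d: "nat \<bar>int n - int m\<bar> = nat \<bar>int m - int n\<bar>" for m n
    by (simp add: abs_minus_commute)
  have y: "hy t r q = (hy r t q :: nat \<Rightarrow> 'a h_alg)" for q
    by (rule ext) (simp add: hy_def add.commute)
  have q: "- t - r = - r - t" by simp
  show ?thesis
    unfolding prod_ss_def Let_def d[of i j] d[of "i div 3" "j div 3"] q y add.commute[of i j]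
      add.commute[of "i div 3" "j div 3"]
    by (simp only: conj_commute eq_commute[of r t] add.commute cong: if_cong)
qed

lemma prod_aa_commute: "(prod_aa i j :: 'a::field h_alg) = prod_aa j i"
proof -
  have "nat \<bar>i - j\<bar> = nat \<bar>j - i\<bar>" by (simp add: abs_minus_commute)
  then have "hs (of_int i) (nat \<bar>i - j\<bar>) = (hs (of_int j) (nat \<bar>j - i\<bar>) :: 'a h_alg)"
    by (metis hs_of_int_swap)
  then show ?thesis by (simp only: prod_aa_def add.commute)
qed

lemma basis_prod_commute: "basis_prod b c = basis_prod c b"
proof (cases b; cases c)
  fix i j assume "b = Ax i" "c = Ax j"
  then show ?thesis by (simp add: prod_aa_commute)
qed (auto simp: prod_ss_commute split: prod.split)

interpretation h: comm_nonassoc_algebra "h_scale :: 'k::field \<Rightarrow> 'k h_alg \<Rightarrow> 'k h_alg" h_mult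
proof
  fix x y z :: "'k h_alg" and c :: 'k
  show "x \<cdot>\<^sub>h y = y \<cdot>\<^sub>h x"
    unfolding h_mult_def
    by (subst sum.swap) (simp add: mult.commute basis_prod_commute)
  let ?X = "Poly_Mapping.keys x \<union> Poly_Mapping.keys y" and ?Z = "Poly_Mapping.keys z"
  have "Poly_Mapping.keys (x + y) \<subseteq> ?X" by (rule Poly_Mapping.keys_add)
  then show "(x + y) \<cdot>\<^sub>h z = x \<cdot>\<^sub>h z + y \<cdot>\<^sub>h z"
    by (simp add: h_mult_superset[where A = ?X and B = ?Z] lookup_add distrib_right
        h.scale_left_distrib sum.distrib)
  have "Poly_Mapping.keys (c *\<^sub>h x) \<subseteq> Poly_Mapping.keys x" by (auto simp: in_keys_iff)
  then show "(c *\<^sub>h x) \<cdot>\<^sub>h y = c *\<^sub>h (x \<cdot>\<^sub>h y)"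
    by (simp add: h_mult_superset[where A = "Poly_Mapping.keys x" and B = "Poly_Mapping.keys y"]
        h.scale_sum_right mult.assoc)
qed

section \<open>Product rules with integer second index\<close>

definition hsz :: "3 \<Rightarrow> int \<Rightarrow> 'k::field h_alg" where
  "hsz r j = hs r (nat \<bar>j\<bar>)"

text \<open>This is the element \<open>y\<close> of the fifth product rule for \<open>r \<noteq> t\<close>, and \<open>hsz r j\<close> for \<open>r = t\<close>.\<close>

definition hp :: "3 \<Rightarrow> 3 \<Rightarrow> int \<Rightarrow> 'k::field h_alg" where
  "hp r t j = hsz r j + hsz t j - hsz (- r - t) j"

lemma hsz_0 [simp]: "hsz r 0 = 0" by (simp add: hsz_def hs_def)

lemma hsz_minus [simp]: "hsz r (- j) = hsz r j" by (simp add: hsz_def)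

lemma hsz_nondvd: "\<not> 3 dvd j \<Longrightarrow> hsz r j = hsz 0 j"
  unfolding hsz_def by (rule hs_nondvd) (simp add: nat_dvd_iff)

text \<open>As \<open>3 r = 0\<close>. Hence the third class in \<open>hp r r j\<close> is
  \<open>r\<close> itself, and \<open>hp r r j = hsz r j\<close>.\<close>

lemma minus_diff_self_3: "- r - r = (r :: 3)"
  by (cases r rule: cases_mod3) simp_all

text \<open>The correction by \<open>h_star\<close> is absorbed into \<open>hp\<close>: it vanishes
  for equal classes, and otherwise completes \<open>hsz r j\<close> to the combination with a minus
  sign at the third class. At \<open>j = 0\<close> both sides are 0.\<close>

lemma ha_hsz:
  "(ha i :: 'k::field h_alg) \<cdot>\<^sub>h hsz r j =
    (-2) *\<^sub>h ha i + (ha (i - j) + ha (i + j)) - hp (of_int i) r j"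
proof (cases "j = 0")
  case True
  have "(-2) *\<^sub>h ha i + (ha i + ha i) = (0 :: 'k h_alg)"
    by (rule poly_mapping_eqI) (simp add: lookup_add lookup_minus)
  with True show ?thesis by (simp add: hp_def del: h.scale_minus_left)
next
  case False
  let ?n = "nat \<bar>j\<bar>"
  have "ha (i - int ?n) + ha (i + int ?n) = (ha (i - j) + ha (i + j) :: 'k h_alg)"
    by (cases "0 \<le> j") (simp_all add: add.commute)
  moreover have "hs r ?n + h_star (of_bool (of_int i = r) - 1) (of_int i - r) *\<^sub>h
      (hs (r - 1) ?n - hs (r + 1) ?n) = (hp (of_int i) r j :: 'k h_alg)"
    unfolding hp_def hsz_def h_star_def
    by (cases "of_int i :: 3" rule: cases_mod3; cases r rule: cases_mod3)
      (simp_all add: numerals_mod3)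
  moreover have "0 < ?n" using False by simp
  ultimately show ?thesis
    using ha_mult_hs[of ?n i r, where 'k = 'k] by (simp only: hsz_def diff_diff_eq)
qed

lemma ha_ha: "(ha i :: 'k::field h_alg) \<cdot>\<^sub>h ha j = (-2) *\<^sub>h (ha i + ha j) + hsz (of_int i) (i - j)"
  by (simp only: ha_mult_ha hsz_def)

text \<open>Passing to absolute values of \<open>i\<close> and \<open>j\<close> at most swaps
  \<open>\<bar>i - j\<bar>\<close> and \<open>\<bar>i + j\<bar>\<close>, which does not affect the
  sum.\<close>

lemma sum_diff_abs:
  fixes f :: "nat \<Rightarrow> 'a::ab_semigroup_add" and i j :: int
  shows "f (nat \<bar>\<bar>i\<bar> - \<bar>j\<bar>\<bar>) + f (nat (\<bar>i\<bar> + \<bar>j\<bar>)) = f (nat \<bar>i - j\<bar>) + f (nat \<bar>i + j\<bar>)"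
proof -
  have "\<bar>i - j\<bar> = \<bar>\<bar>i\<bar> - \<bar>j\<bar>\<bar> \<and> \<bar>i + j\<bar> = \<bar>i\<bar> + \<bar>j\<bar> \<or>
      \<bar>i + j\<bar> = \<bar>\<bar>i\<bar> - \<bar>j\<bar>\<bar> \<and> \<bar>i - j\<bar> = \<bar>i\<bar> + \<bar>j\<bar>"
    by arith
  then show ?thesis by (metis add.commute)
qed

text \<open>The rules for equal and for distinct classes merge, since
  \<open>hp r r j = hsz r j\<close>. If \<open>i\<close> or \<open>j\<close> is 0, the right side
  vanishes because \<open>hp r t\<close> is even and zero at 0.\<close>

lemma hsz_hsz_dvd:
  assumes "3 dvd i" "3 dvd j"
  shows "(hsz r i :: 'k::field h_alg) \<cdot>\<^sub>h hsz t j =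
    2 *\<^sub>h (hp r t i + hp r t j) - (hp r t (i - j) + hp r t (i + j))"
proof (cases "i = 0 \<or> j = 0")
  case True
  have "2 *\<^sub>h x = x + x" for x :: "'k h_alg"
    by (rule poly_mapping_eqI) (simp add: lookup_add)
  with True show ?thesis by (auto simp: hp_def)
next
  case False
  define h k where "h = nat (\<bar>i\<bar> div 3)" and "k = nat (\<bar>j\<bar> div 3)"
  have "\<bar>i\<bar> = 3 * int h" "\<bar>j\<bar> = 3 * int k"
    using assms by (simp_all add: h_def k_def pos_imp_zdiv_nonneg_iff)
  with False have hk: "nat \<bar>i\<bar> = 3 * h" "nat \<bar>j\<bar> = 3 * k" "0 < h" "0 < k"
    by linarith+
  have "nat \<bar>\<bar>i\<bar> - \<bar>j\<bar>\<bar> = 3 * nat \<bar>int h - int k\<bar>"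
    unfolding \<open>\<bar>i\<bar> = 3 * int h\<close> \<open>\<bar>j\<bar> = 3 * int k\<close> by linarith
  moreover have "nat (\<bar>i\<bar> + \<bar>j\<bar>) = 3 * (h + k)"
    using hk(1,2) by (simp add: nat_add_distrib)
  ultimately have sumdiff: "f (3 * nat \<bar>int h - int k\<bar>) + f (3 * (h + k)) =
      f (nat \<bar>i - j\<bar>) + f (nat \<bar>i + j\<bar>)" for f :: "nat \<Rightarrow> 'k h_alg"
    using sum_diff_abs[of f i j] by simp
  show ?thesis
  proof (cases "r = t")
    case True
    then show ?thesis
      using hs_mult_hs_same[OF hk(3,4), of r, where 'k = 'k] sumdiff[of "hs r"]
      by (simp add: hp_def minus_diff_self_3 hsz_def hk(1,2))
  next
    case False
    then have "x \<in> {r, t, - r - t}" for x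
      by (cases r rule: cases_mod3; cases t rule: cases_mod3; cases x rule: cases_mod3)
        (simp_all add: numerals_mod3)
    then have "{r, t, - r - t} = UNIV" by blast
    then show ?thesis
      using hs_mult_hs_distinct[OF hk(3,4), where 'k = 'k]
        sumdiff[of "\<lambda>m. hs r m + hs t m - hs (- r - t) m"]
      by (simp add: hp_def hy_def hsz_def hk(1,2))
  qed
qed

text \<open>If one index is 0, the right side becomes \<open>-10\<close> times the other
  \<open>hsz\<close>, which need not be 0 over an arbitrary field; hence both indices are nonzero
  here.\<close>

lemma hsz_hsz_nondvd:
  assumes "\<not> (3 dvd i \<and> 3 dvd j)" "i \<noteq> 0" "j \<noteq> 0"
  shows "(hsz r i :: 'k::field h_alg) \<cdot>\<^sub>h hsz t j = 2 *\<^sub>h (hsz r i + hsz t j)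
    - 2 *\<^sub>h (hsz 0 (i - j) + hsz 1 (i - j) + hsz 2 (i - j)
      + hsz 0 (i + j) + hsz 1 (i + j) + hsz 2 (i + j))"
proof -
  let ?T = "\<lambda>m. hs 0 m + hs 1 m + hs 2 m :: 'k h_alg"
  let ?d = "nat \<bar>int (nat \<bar>i\<bar>) - int (nat \<bar>j\<bar>)\<bar>" and ?s = "nat \<bar>i\<bar> + nat \<bar>j\<bar>"
  have "nat \<bar>\<bar>i\<bar> - \<bar>j\<bar>\<bar> = ?d" "nat (\<bar>i\<bar> + \<bar>j\<bar>) = ?s"
    by (simp_all add: nat_add_distrib)
  then have "?T ?d + ?T ?s = ?T (nat \<bar>i - j\<bar>) + ?T (nat \<bar>i + j\<bar>)"
    using sum_diff_abs[of ?T i j] by (simp only:)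
  moreover have pos: "0 < nat \<bar>i\<bar>" "0 < nat \<bar>j\<bar>" "\<not> (3 dvd nat \<bar>i\<bar> \<and> 3 dvd nat \<bar>j\<bar>)"
    using assms by (simp_all add: nat_dvd_iff)
  ultimately show ?thesis
    using hs_mult_hs[OF pos, of r t, where 'k = 'k]
    by (simp only: hsz_def add.assoc)
qed

section \<open>A spanning set and the reflections\<close>

definition h_gens :: "'k::field h_alg set" where
  "h_gens = range ha \<union> {hsz r j | r j. True}"

lemma single_in_h_gens: "Poly_Mapping.single b 1 \<in> h_gens"
proof (cases b)
  case (Ax i)
  then show ?thesis by (auto simp: h_gens_def ha_def)
next
  case (Sx u)
  obtain r j where u: "Rep_s_index u = (r, j)" by fastforce
  then have "0 < j" "r = 0 \<or> 3 dvd j" "u = Abs_s_index (r, j)"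
    using Rep_s_index[of u] Rep_s_index_inverse[of u] by auto
  then have "Poly_Mapping.single b 1 = hsz r (int j)"
    using Sx by (auto simp: hsz_def hs_def)
  then show ?thesis by (auto simp: h_gens_def)
qed

lemma span_h_gens: "h.span h_gens = UNIV"
proof -
  have "x \<in> h.span h_gens" for x :: "'a h_alg"
  proof -
    have "x = (\<Sum>b\<in>Poly_Mapping.keys x. Poly_Mapping.lookup x b *\<^sub>h Poly_Mapping.single b 1)"
      by (rule poly_mapping_eqI)
        (simp add: lookup_sum lookup_single when_def in_keys_iff if_distrib[of "(*) _"] cong: if_cong)
    also have "\<dots> \<in> h.span h_gens"
      by (intro h.span_sum h.span_scale h.span_base single_in_h_gens)
    finally show ?thesis .
  qed
  then show ?thesis by blast
qed

text \<open>The reflection about \<open>c / 2\<close> on basis labels. For \<open>j\<close> not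
  divisible by 3 the class has to stay at the chosen representative 0.\<close>

definition flip_index :: "int \<Rightarrow> h_basis \<Rightarrow> h_basis" where
  "flip_index c b = (case b of Ax i \<Rightarrow> Ax (c - i) | Sx u \<Rightarrow> (case Rep_s_index u of (r, j) \<Rightarrow>
     Sx (Abs_s_index (if 3 dvd j then of_int c - r else 0, j))))"

lemma flip_index_flip_index: "flip_index c (flip_index c b) = b"
proof (cases b)
  case (Sx u)
  obtain r j where u: "Rep_s_index u = (r, j)" by fastforce
  then have "0 < j" "r = 0 \<or> 3 dvd j" "u = Abs_s_index (r, j)"
    using Rep_s_index[of u] Rep_s_index_inverse[of u] by auto
  then show ?thesis using Sx u by (auto simp: flip_index_def Abs_s_index_inverse)
qed (simp add: flip_index_def)

lemma inj_flip_index: "inj (flip_index c)"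
  by (metis flip_index_flip_index injI)

text \<open>\<open>map_key\<close> composes coefficient functions with \<open>flip_index c\<close>;
  as this is an involution, basis vectors are moved by \<open>flip_index c\<close> itself.\<close>

definition h_flip :: "int \<Rightarrow> 'k::field h_alg \<Rightarrow> 'k h_alg" where
  "h_flip c = Poly_Mapping.map_key (flip_index c)"

lemma lookup_h_flip: "Poly_Mapping.lookup (h_flip c x) b = Poly_Mapping.lookup x (flip_index c b)"
  by (simp add: h_flip_def map_key.rep_eq[OF inj_flip_index])

interpretation h_flip: Vector_Spaces.linear h_scale h_scale "h_flip c :: 'k::field h_alg \<Rightarrow> 'k h_alg"
  by unfold_locales (auto intro!: poly_mapping_eqI simp: lookup_h_flip lookup_add)

lemma h_flip_h_flip: "h_flip c (h_flip c x) = x"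
  by (rule poly_mapping_eqI) (simp add: lookup_h_flip flip_index_flip_index)

lemma h_flip_single: "h_flip c (Poly_Mapping.single b v) = Poly_Mapping.single (flip_index c b) v"
  unfolding h_flip_def by (metis flip_index_flip_index inj_flip_index map_key_single)

lemma h_flip_ha: "h_flip c (ha i) = ha (c - i)"
  by (simp add: ha_def h_flip_single flip_index_def)

lemma h_flip_hsz: "h_flip c (hsz r j) = hsz (of_int c - r) j"
  by (auto simp: hsz_def hs_def h_flip_single flip_index_def Abs_s_index_inverse)

lemma h_flip_hp: "h_flip c (hp r t j) = hp (of_int c - r) (of_int c - t) j"
proof -
  \<comment> \<open>The two sides differ by \<open>3 c\<close>, which is 0 modulo 3, so the
    reflection respects the third class.\<close>
  have "of_int c - (- r - t) = - (of_int c - r) - (of_int c - t)"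
    by (cases "of_int c :: 3" rule: cases_mod3; cases r rule: cases_mod3; cases t rule: cases_mod3)
      simp_all
  then show ?thesis
    unfolding hp_def by (simp only: h_flip.add h_flip.diff h_flip_hsz)
qed

text \<open>A reflection only permutes the three classes.\<close>

lemma h_flip_hsz_sum:
  "h_flip c (hsz 0 j + hsz 1 j + hsz 2 j) = hsz 0 j + hsz 1 j + hsz 2 j"
  by (cases "of_int c :: 3" rule: cases_mod3)
    (simp_all add: h_flip.add h_flip_hsz numerals_mod3 add_ac)

lemma h_flip_ha_mult_hsz:
  "h_flip c (ha i \<cdot>\<^sub>h hsz r j) = h_flip c (ha i) \<cdot>\<^sub>h h_flip c (hsz r j)"
  by (simp only: ha_hsz h_flip.add h_flip.diff h_flip.scale h_flip_ha h_flip_hsz h_flip_hp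
      of_int_diff) (simp add: algebra_simps)

lemma h_flip_hsz_mult_hsz:
  "h_flip c (hsz r i \<cdot>\<^sub>h hsz t j) = h_flip c (hsz r i) \<cdot>\<^sub>h h_flip c (hsz t j)"
proof -
  consider "i = 0" | "j = 0" | "3 dvd i" "3 dvd j" | "\<not> (3 dvd i \<and> 3 dvd j)" "i \<noteq> 0" "j \<noteq> 0"
    by blast
  then show ?thesis
  proof cases
    case 3
    show ?thesis
      by (simp only: hsz_hsz_dvd[OF 3] h_flip.add h_flip.diff h_flip.scale h_flip_hsz h_flip_hp)
  next
    case 4
    have "h_flip c (hsz r i \<cdot>\<^sub>h hsz t j) = 2 *\<^sub>h (h_flip c (hsz r i) + h_flip c (hsz t j))
      - 2 *\<^sub>h (h_flip c (hsz 0 (i - j) + hsz 1 (i - j) + hsz 2 (i - j))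
        + h_flip c (hsz 0 (i + j) + hsz 1 (i + j) + hsz 2 (i + j)))"
      by (simp only: hsz_hsz_nondvd[OF 4] h_flip.add h_flip.diff h_flip.scale add.assoc)
    then show ?thesis
      unfolding h_flip_hsz_sum h_flip_hsz by (simp only: hsz_hsz_nondvd[OF 4] add.assoc)
  qed (simp_all add: h_flip_hsz h_flip.zero)
qed

text \<open>Both sides are bilinear, so the spanning set \<open>h_gens\<close> suffices.\<close>

lemma h_flip_mult: "h_flip c (x \<cdot>\<^sub>h y) = h_flip c x \<cdot>\<^sub>h h_flip c y"
proof -
  have gens: "h_flip c (x \<cdot>\<^sub>h y) = h_flip c x \<cdot>\<^sub>h h_flip c y"
    if "x \<in> h_gens" "y \<in> h_gens" for x y :: "'a h_alg"
  proof -
    \<comment> \<open>The reflected indices differ by \<open>(c - i) - (c - j) = - (i - j)\<close>,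
      and \<open>hsz\<close> is even.\<close>
    have "h_flip c (ha i \<cdot>\<^sub>h ha j :: 'a h_alg) = h_flip c (ha i) \<cdot>\<^sub>h h_flip c (ha j)" for i j
      using hsz_minus[of "of_int c - of_int i" "i - j", where 'a = 'a]
      by (simp add: ha_ha h_flip.add h_flip.diff h_flip.scale h_flip.neg h_flip_ha h_flip_hsz)
    moreover have "h_flip c (hsz r j \<cdot>\<^sub>h ha i :: 'a h_alg) = h_flip c (hsz r j) \<cdot>\<^sub>h h_flip c (ha i)"
      for r i j by (metis h.mult_commute h_flip_ha_mult_hsz)
    moreover note h_flip_ha_mult_hsz h_flip_hsz_mult_hsz
    ultimately show ?thesis
      using that unfolding h_gens_def by blast
  qed
  have "h_flip c (x \<cdot>\<^sub>h y) = h_flip c x \<cdot>\<^sub>h h_flip c y" if x: "x \<in> h_gens" for x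
    using span_h_gens[THEN equalityD2, THEN subsetD, OF UNIV_I, of y]
  proof (induction rule: h.span_induct)
    case base
    show ?case
      by (intro h.subspaceI CollectI)
        (simp_all add: h_flip.zero h_flip.add h_flip.scale h.mult_add_right h.mult_scale_right)
  qed (rule gens[OF x])
  note left = this
  show ?thesis
    using span_h_gens[THEN equalityD2, THEN subsetD, OF UNIV_I, of x]
  proof (induction rule: h.span_induct)
    case base
    show ?case
      by (intro h.subspaceI CollectI)
        (simp_all add: h_flip.zero h_flip.add h_flip.scale h.mult_add_left h.mult_scale_left)
  qed (rule left)
qed

lemma automorphism_h_flip: "h.automorphism (h_flip c)"
  unfolding h.automorphism_def
  by (auto simp: h_flip_mult h_flip_h_flip intro!: h_flip.linear_axioms o_bij[of "h_flip c"])

subsection \<open>Eigenvectors of the axis\<close>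

definition hA :: "int \<Rightarrow> 'k::field h_alg" where
  "hA j = ha j + ha (- j)"

definition hZ :: "int \<Rightarrow> 'k::field h_alg" where
  "hZ j = hsz 1 j + hsz 2 j - 2 *\<^sub>h hsz 0 j"

definition hu :: "int \<Rightarrow> 'k::field h_alg" where
  "hu j = hA j + 2 *\<^sub>h hsz 0 j - 2 *\<^sub>h ha 0"

definition hv :: "int \<Rightarrow> 'k::field h_alg" where
  "hv j = hA j - hsz 0 j - 2 *\<^sub>h ha 0"

text \<open>The last branch is meant for \<open>3 = 1/2\<close>; the other arguments used are 1, 0
  and 2.\<close>

definition h_eigengens :: "'k::field \<Rightarrow> 'k h_alg set" where
  "h_eigengens \<mu> =
     (if \<mu> = 1 then {ha 0}
      else if \<mu> = 0 then range hu \<union> range hZ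
      else if \<mu> = 2 then range hv
      else {ha j - ha (- j) | j. True} \<union> {hsz 1 j - hsz 2 j | j. True})"

lemmas h_linear = h.mult_add_left h.mult_add_right h.mult_diff_left h.mult_diff_right
  h.mult_minus_left h.mult_minus_right h.mult_scale_left h.mult_scale_right

lemmas lookup_linear = lookup_add lookup_minus lookup_uminus lookup_h_scale lookup_zero

lemma of_int_3_cases:
  obtains "3 dvd i" "of_int i = (0 :: 3)" | "\<not> 3 dvd i" "of_int i = (1 :: 3)"
    | "\<not> 3 dvd i" "of_int i = (2 :: 3)"
  using cases_mod3[of "of_int i"] of_int_3_eq_0_iff[of i] by fastforce

text \<open>All three classes give the same \<open>s\<close>, and the coefficients 1, 1, -2 sum to
  0.\<close>

lemma hZ_nondvd: "\<not> 3 dvd j \<Longrightarrow> hZ j = (0 :: 'k::field h_alg)"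
  unfolding hZ_def hsz_nondvd[of j 1] hsz_nondvd[of j 2]
  by (rule poly_mapping_eqI) (simp add: lookup_linear)

lemma hsz_diff_swap: "hsz r (- i - j) = hsz r (i + j)" "hsz r (- i + j) = hsz r (i - j)"
  using hsz_minus[of r "i + j"] hsz_minus[of r "i - j"] by simp_all

section \<open>Products of reflection-invariant elements in characteristic 5\<close>

context
  assumes five: "(5 :: 'k::field) = 0"
begin

text \<open>Rules for reducing collected coefficients modulo 5.\<close>

lemma char5_simps:
  "(5 :: 'k) = 0" "(10 :: 'k) = 0" "(15 :: 'k) = 0" "(20 :: 'k) = 0" "(25 :: 'k) = 0" "(30 :: 'k) = 0"
  "(6 :: 'k) = 1"
proof -
  have *: "(5 * x :: 'k) = 0" for x by (simp only: five mult_zero_left)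
  show "(5 :: 'k) = 0" using *[of 1] by simp
  show "(10 :: 'k) = 0" using *[of 2] by simp
  show "(15 :: 'k) = 0" using *[of 3] by simp
  show "(20 :: 'k) = 0" using *[of 4] by simp
  show "(25 :: 'k) = 0" using *[of 5] by simp
  show "(30 :: 'k) = 0" using *[of 6] by simp
  have "(6 :: 'k) = 5 + 1" by simp
  then show "(6 :: 'k) = 1" by (simp only: five add_0)
qed

text \<open>Here \<open>-4 = 1\<close>. The four \<open>s\<close> terms carry the classes of
  \<open>i\<close> and \<open>- i\<close>; if 3 does not divide \<open>i\<close>, these are 1 and 2,
  and \<open>s\<^sub>1 + s\<^sub>2 = 2 s\<^sub>0 + hZ\<close>. The factor of \<open>hZ\<close>
  mentions only \<open>i\<close>, yet is symmetric in effect: if 3 divides exactly one of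
  \<open>i\<close> and \<open>j\<close>, both \<open>hZ\<close> are 0.\<close>

lemma hA_mult_hA:
  "(hA i :: 'k h_alg) \<cdot>\<^sub>h hA j = hA i + hA j + 2 *\<^sub>h (hsz 0 (i - j) + hsz 0 (i + j))
    + of_bool (\<not> 3 dvd i) *\<^sub>h (hZ (i - j) + hZ (i + j))"
  unfolding hA_def h_linear ha_ha hZ_def of_int_minus
  by (cases i rule: of_int_3_cases; simp only: hsz_diff_swap numerals_mod3 simp_thms
      of_bool_eq diff_minus_eq_add minus_zero; rule poly_mapping_eqI;
        simp add: lookup_linear algebra_simps char5_simps)

text \<open>The contributions of \<open>i\<close> and \<open>- i\<close> are exchanged by swapping
  classes 1 and 2, so their \<open>s\<^sub>1 - s\<^sub>2\<close> parts cancel.\<close>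

lemma hA_mult_hsz:
  "(hA i :: 'k h_alg) \<cdot>\<^sub>h hsz 0 j = (-2) *\<^sub>h hA i + (hA (i - j) + hA (i + j)) - 2 *\<^sub>h hsz 0 j"
proof -
  have "- (i - j) = - i + j" "- (i + j) = - i - j" by simp_all
  then show ?thesis
    unfolding hA_def h_linear ha_hsz hp_def of_int_minus
    by - (cases i rule: of_int_3_cases; simp only: numerals_mod3 minus_zero diff_zero;
        rule poly_mapping_eqI;
        simp add: lookup_linear algebra_simps char5_simps)
qed

text \<open>If 3 does not divide \<open>i\<close>, then
  \<open>-2 (s\<^sub>0 + s\<^sub>1 + s\<^sub>2) = -6 s\<^sub>0 - 2 hZ\<close>, and
  \<open>-6 = -1\<close>. In the remaining cases \<open>hZ\<close> is 0 or has factor 0.\<close>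

lemma hsz_mult_hsz:
  "(hsz 0 i :: 'k h_alg) \<cdot>\<^sub>h hsz 0 j = 2 *\<^sub>h (hsz 0 i + hsz 0 j)
    - (hsz 0 (i - j) + hsz 0 (i + j)) - (2 * of_bool (\<not> 3 dvd i)) *\<^sub>h (hZ (i - j) + hZ (i + j))"
proof -
  consider "i = 0" | "j = 0" | "3 dvd i" "3 dvd j" | "3 dvd i" "\<not> 3 dvd j" "i \<noteq> 0" "j \<noteq> 0"
    | "\<not> 3 dvd i" "i \<noteq> 0" "j \<noteq> 0"
    by (cases "3 dvd j") auto
  then show ?thesis
  proof cases
    case 1
    then show ?thesis
      by (simp add: poly_mapping_eq_iff fun_eq_iff lookup_linear algebra_simps)
  next
    case 2
    show ?thesis
      unfolding 2
      by (cases "3 dvd i"; rule poly_mapping_eqI;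
          simp add: hZ_nondvd lookup_linear algebra_simps)
  next
    case 3
    then show ?thesis
      by (simp add: hsz_hsz_dvd hp_def)
  next
    case 4
    then have "\<not> 3 dvd i - j" "\<not> 3 dvd i + j"
      by (simp_all add: dvd_diff_right_iff dvd_add_right_iff)
    note hsz_nd = hsz_nondvd[OF this(1), of 1] hsz_nondvd[OF this(1), of 2]
      hsz_nondvd[OF this(2), of 1] hsz_nondvd[OF this(2), of 2]
    have nd: "\<not> (3 dvd i \<and> 3 dvd j)" using 4 by simp
    from 4 show ?thesis
      unfolding hsz_hsz_nondvd[OF nd 4(3,4)] hsz_nd
      by - (rule poly_mapping_eqI; simp add: lookup_linear algebra_simps char5_simps)
  next
    case 5
    then have nd: "\<not> (3 dvd i \<and> 3 dvd j)" by simp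
    from 5 show ?thesis
      unfolding hsz_hsz_nondvd[OF nd 5(2,3)] hZ_def
      by - (rule poly_mapping_eqI; simp add: lookup_linear algebra_simps char5_simps)
  qed
qed

text \<open>The coefficients of \<open>hZ\<close> sum to 0, so all \<open>ha\<close> cancel; for
  \<open>i\<close> not divisible by 3, \<open>-3 = 2\<close> times \<open>hZ j\<close>
  remains.\<close>

lemma hA_mult_hZ: "(hA i :: 'k h_alg) \<cdot>\<^sub>h hZ j = (2 * of_bool (\<not> 3 dvd i)) *\<^sub>h hZ j"
  unfolding hA_def hZ_def h_linear ha_hsz hp_def of_int_minus
  by (cases i rule: of_int_3_cases; simp only: numerals_mod3 minus_zero diff_zero simp_thms
      of_bool_eq; rule poly_mapping_eqI;
      simp add: numerals_mod3 lookup_linear algebra_simps char5_simps)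

text \<open>Let 3 divide \<open>j\<close>. If 3 also divides \<open>i\<close>, each index
  contributes \<open>hp 0 1 + hp 0 2 - 2 hp 0 0 = 0\<close>. Otherwise the terms independent of the
  class cancel, and twice \<open>hZ j\<close> is left.\<close>

lemma hsz_mult_hZ: "(hsz 0 i :: 'k h_alg) \<cdot>\<^sub>h hZ j = (2 * of_bool (\<not> 3 dvd i)) *\<^sub>h hZ j"
proof (cases "3 dvd j \<and> i \<noteq> 0 \<and> j \<noteq> 0")
  case True
  then have j: "3 dvd j" and nz: "i \<noteq> 0" "j \<noteq> 0" by auto
  show ?thesis
  proof (cases "3 dvd i")
    case True
    then show ?thesis
      unfolding hZ_def h_linear hsz_hsz_dvd[OF True j] hp_def
      by - (rule poly_mapping_eqI;
          simp add: numerals_mod3 lookup_linear algebra_simps char5_simps)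
  next
    case False
    then have nd: "\<not> (3 dvd i \<and> 3 dvd j)" by simp
    from False show ?thesis
      unfolding hZ_def h_linear hsz_hsz_nondvd[OF nd nz]
      by - (rule poly_mapping_eqI;
          simp add: numerals_mod3 lookup_linear algebra_simps char5_simps)
  qed
next
  case False
  then show ?thesis
  proof (cases "i = 0")
    case True
    then show ?thesis by simp
  next
    case False
    with \<open>\<not> (3 dvd j \<and> i \<noteq> 0 \<and> j \<noteq> 0)\<close> have "hZ j = (0 :: 'k h_alg)"
      by (cases "j = 0") (simp_all add: hZ_nondvd, simp add: hZ_def)
    then show ?thesis by simp
  qed
qed

lemma hZ_mult_hZ:
  assumes "3 dvd i" "3 dvd j"
  shows "(hZ i :: 'k h_alg) \<cdot>\<^sub>h hZ j = 3 *\<^sub>h (2 *\<^sub>h (hZ i + hZ j) - hZ (i - j) - hZ (i + j))"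
  unfolding hZ_def h_linear hsz_hsz_dvd[OF assms] hp_def
  by (rule poly_mapping_eqI;
      simp add: numerals_mod3 lookup_linear algebra_simps char5_simps)

lemma ha_mult_hA: "(ha 0 :: 'k h_alg) \<cdot>\<^sub>h hA j = ha 0 - 2 *\<^sub>h hA j + 2 *\<^sub>h hsz 0 j"
  unfolding hA_def h_linear ha_ha
  by (rule poly_mapping_eqI;
      simp add: numerals_mod3 lookup_linear algebra_simps char5_simps)

lemma ha_mult_hsz: "(ha 0 :: 'k h_alg) \<cdot>\<^sub>h hsz 0 j = (-2) *\<^sub>h ha 0 + hA j - hsz 0 j"
  unfolding hA_def h_linear ha_hsz hp_def
  by (rule poly_mapping_eqI;
      simp add: numerals_mod3 lookup_linear algebra_simps char5_simps)

lemma ha_mult_hZ: "(ha 0 :: 'k h_alg) \<cdot>\<^sub>h hZ j = 0"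
  unfolding hZ_def h_linear ha_hsz hp_def
  by (rule poly_mapping_eqI;
      simp add: numerals_mod3 lookup_linear algebra_simps char5_simps)

lemma ha_mult_ha_0: "(ha 0 :: 'k h_alg) \<cdot>\<^sub>h ha 0 = ha 0"
  unfolding ha_ha
  by (rule poly_mapping_eqI; simp add: lookup_linear algebra_simps char5_simps)

lemmas h_plus_products = hA_mult_hA hA_mult_hsz hsz_mult_hsz ha_mult_hA ha_mult_hsz ha_mult_ha_0
  hA_mult_hZ hsz_mult_hZ ha_mult_hZ

section \<open>Eigenvalues and products of the eigenvectors\<close>

lemma ha_mult_hu: "(ha 0 :: 'k h_alg) \<cdot>\<^sub>h hu j = 0"
  unfolding hu_def h_linear h_plus_products
  by (rule poly_mapping_eqI; simp add: lookup_linear algebra_simps char5_simps)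

lemma ha_mult_hv: "(ha 0 :: 'k h_alg) \<cdot>\<^sub>h hv j = 2 *\<^sub>h hv j"
  unfolding hv_def h_linear h_plus_products
  by (rule poly_mapping_eqI; simp add: lookup_linear algebra_simps char5_simps)

lemma ha_mult_ha_diff:
  "(ha 0 :: 'k h_alg) \<cdot>\<^sub>h (ha j - ha (- j)) = 3 *\<^sub>h (ha j - ha (- j))"
  unfolding h_linear ha_ha
  by (rule poly_mapping_eqI; simp add: lookup_linear algebra_simps char5_simps)

lemma ha_mult_hsz_diff:
  "(ha 0 :: 'k h_alg) \<cdot>\<^sub>h (hsz 1 j - hsz 2 j) = 3 *\<^sub>h (hsz 1 j - hsz 2 j)"
  unfolding h_linear ha_hsz hp_def
  by (rule poly_mapping_eqI;
      simp add: numerals_mod3 lookup_linear algebra_simps char5_simps)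

lemma h_plus_commute:
  "(hsz r i :: 'k h_alg) \<cdot>\<^sub>h hA j = hA j \<cdot>\<^sub>h hsz r i" "(hA j :: 'k h_alg) \<cdot>\<^sub>h ha 0 = ha 0 \<cdot>\<^sub>h hA j"
  "(hsz r j :: 'k h_alg) \<cdot>\<^sub>h ha 0 = ha 0 \<cdot>\<^sub>h hsz r j"
  by (rule h.mult_commute)+

lemma hA_diff_swap: "hA (j - i) = hA (i - j)"
  by (simp add: hA_def add.commute)

lemma hsz_diff_commute: "hsz r (j - i) = hsz r (i - j)"
  using hsz_minus[of r "i - j"] by simp

text \<open>Expansion in \<open>hA\<close>, \<open>hsz\<close>, \<open>ha 0\<close> and
  \<open>hZ\<close>, then comparison of coefficients modulo 5. Only vectors with eigenvalue 0
  appear, as the rule for 0 with 0 demands.\<close>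

lemma hu_mult_hu:
  "(hu i :: 'k h_alg) \<cdot>\<^sub>h hu j = 2 *\<^sub>h (hu i + hu j) + 4 *\<^sub>h (hu (i - j) + hu (i + j))
    - (2 * of_bool (\<not> 3 dvd i)) *\<^sub>h (hZ (i - j) + hZ (i + j))"
  unfolding hu_def h_linear h_plus_commute h_plus_products hA_diff_swap[of j i]
    hsz_diff_commute[of _ j i] add.commute[of j i]
  by (rule poly_mapping_eqI; simp only: lookup_linear;
      simp add: algebra_simps char5_simps)

lemma hu_mult_hv:
  "(hu i :: 'k h_alg) \<cdot>\<^sub>h hv j = 3 *\<^sub>h hv i - 2 *\<^sub>h hv j + hv (i - j) + hv (i + j)"
  unfolding hu_def hv_def h_linear h_plus_commute h_plus_products hA_diff_swap[of j i]
    hsz_diff_commute[of _ j i] add.commute[of j i]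
  by (rule poly_mapping_eqI; simp only: lookup_linear;
      simp add: algebra_simps char5_simps)

text \<open>All \<open>ha 0\<close> and \<open>hv\<close> components cancel, so the product falls
  into the 0-eigenspace, inside the sum for 1 and 0 that the law prescribes.\<close>

lemma hv_mult_hv:
  "(hv i :: 'k h_alg) \<cdot>\<^sub>h hv j = - (hu i + hu j) - 2 *\<^sub>h (hu (i - j) + hu (i + j))
    - of_bool (\<not> 3 dvd i) *\<^sub>h (hZ (i - j) + hZ (i + j))"
  unfolding hu_def hv_def h_linear h_plus_commute h_plus_products hA_diff_swap[of j i]
    hsz_diff_commute[of _ j i] add.commute[of j i]
  by (rule poly_mapping_eqI; simp only: lookup_linear;
      simp add: algebra_simps char5_simps)

lemma hu_mult_hZ: "(hu i :: 'k h_alg) \<cdot>\<^sub>h hZ j = of_bool (\<not> 3 dvd i) *\<^sub>h hZ j"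
  unfolding hu_def h_linear h_plus_products
  by (rule poly_mapping_eqI; simp add: lookup_linear algebra_simps char5_simps)

lemma hv_mult_hZ: "(hv i :: 'k h_alg) \<cdot>\<^sub>h hZ j = 0"
  unfolding hv_def h_linear h_plus_products
  by (rule poly_mapping_eqI; simp add: lookup_linear algebra_simps char5_simps)

lemma char5_neqs:
  "(2 :: 'k) \<noteq> 0" "(3 :: 'k) \<noteq> 0" "(2 :: 'k) \<noteq> 1" "(3 :: 'k) \<noteq> 1" "(3 :: 'k) \<noteq> 2"
proof -
  \<comment> \<open>Equality in any of the five cases would lead through these identities to
    \<open>1 = 0\<close>; for \<open>3 = 1\<close> this goes by way of \<open>2 = 0\<close>.\<close>
  have "(1 :: 'k) = 5 - 2 * 2" "(1 :: 'k) = 3 * 2 - 5" "(1 :: 'k) = 2 - 1" "(2 :: 'k) = 3 - 1"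
    "(1 :: 'k) = 3 - 2"
    by simp_all
  then show *: "(2 :: 'k) \<noteq> 0" "(3 :: 'k) \<noteq> 0" "(2 :: 'k) \<noteq> 1" "(3 :: 'k) \<noteq> 1" "(3 :: 'k) \<noteq> 2"
    unfolding five by (metis cancel_comm_monoid_add_class.diff_cancel diff_0_right mult_zero_left zero_neq_one)+
qed

lemmas char5_eigenvalues = char5_neqs char5_neqs[symmetric]

lemma half_eq_three: "(1 / 2 :: 'k) = 3"
proof -
  have "(3 * 2 :: 'k) = 5 + 1" by simp
  then show ?thesis using char5_neqs(1) five by (simp add: divide_eq_eq)
qed

section \<open>Determination of the eigenspaces\<close>

lemma h_eigengens_subset: "h_eigengens \<kappa> \<subseteq> h.eigenspace (ha 0 :: 'k h_alg) \<kappa>"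
  if "\<kappa> \<in> {1, 0, 2, 3}"
  using that
  by (auto simp: h_eigengens_def h.eigenspace_def char5_eigenvalues ha_mult_ha_0 ha_mult_hu
      ha_mult_hZ ha_mult_hv ha_mult_ha_diff ha_mult_hsz_diff)

lemma h_eigen_decomposition:
  obtains w1 w0 w2 w3 where "w1 \<in> h.span (h_eigengens 1)" "w0 \<in> h.span (h_eigengens 0)"
    "w2 \<in> h.span (h_eigengens 2)" "w3 \<in> h.span (h_eigengens 3)"
    "x = w1 + (w0 + (w2 + w3 :: 'k h_alg))"
proof -
  let ?G = "h_eigengens 1 \<union> (h_eigengens 0 \<union> (h_eigengens 2 \<union> h_eigengens 3)) :: 'k h_alg set"
  have mem: "ha 0 \<in> h.span ?G" "hu j \<in> h.span ?G" "hv j \<in> h.span ?G" "hZ j \<in> h.span ?G"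
    "ha j - ha (- j) \<in> h.span ?G" "hsz 1 j - hsz 2 j \<in> h.span ?G" for j
    by (rule h.span_base, auto simp: h_eigengens_def char5_eigenvalues)+
  have S: "hsz 0 j \<in> h.span ?G" for j
  proof -
    \<comment> \<open>The difference is three times \<open>hsz 0 j\<close>, and
      \<open>2 * 3 = 1\<close>.\<close>
    have "(hsz 0 j :: 'k h_alg) = 2 *\<^sub>h (hu j - hv j)"
      unfolding hu_def hv_def
      by (rule poly_mapping_eqI; simp add: lookup_linear algebra_simps char5_simps)
    then show ?thesis by (simp add: h.span_diff h.span_scale mem)
  qed
  \<comment> \<open>The first three summands give \<open>hA j\<close>, so the bracket is twice
    \<open>ha j\<close>; the factor 3 halves it.\<close>
  have "(ha j :: 'k h_alg) = 3 *\<^sub>h (hv j + hsz 0 j + 2 *\<^sub>h ha 0 + (ha j - ha (- j)))" for j :: int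
    unfolding hA_def hv_def
    by (rule poly_mapping_eqI; simp add: lookup_linear algebra_simps char5_simps)
  then have A: "ha j \<in> h.span ?G" for j
    by (metis h.span_add h.span_scale mem(1,3,5) S)
  \<comment> \<open>Likewise the bracket is twice \<open>hsz 1 j\<close>.\<close>
  have "(hsz 1 j :: 'k h_alg) = 3 *\<^sub>h (hZ j + 2 *\<^sub>h hsz 0 j + (hsz 1 j - hsz 2 j))" for j
    unfolding hZ_def
    by (rule poly_mapping_eqI; simp add: lookup_linear algebra_simps char5_simps)
  then have S1: "hsz 1 j \<in> h.span ?G" for j
    by (metis h.span_add h.span_scale mem(4,6) S)
  have "(hsz 2 j :: 'k h_alg) = hsz 1 j - (hsz 1 j - hsz 2 j)" for j by simp
  then have S2: "hsz 2 j \<in> h.span ?G" for j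
    by (metis h.span_diff mem(6) S1)
  have "hsz r j \<in> h.span ?G" for r j
    by (cases r rule: cases_mod3) (simp_all only: S S1 S2)
  with A have "h_gens \<subseteq> h.span ?G" unfolding h_gens_def by blast
  then have "h.span h_gens \<subseteq> h.span ?G" by (rule h.span_minimal) simp
  then have "x \<in> h.span ?G" unfolding span_h_gens by blast
  then show thesis using that unfolding h.span_Un by blast
qed

text \<open>The spans lie in the eigenspaces and jointly fill the algebra, so independence of
  eigenvectors forces equality. The case \<open>\<mu> = 1\<close> yields primitivity.\<close>

lemma h_eigenspace_eq:
  assumes "\<mu> \<in> {1, 0, 2, 3}"
  shows "h.eigenspace (ha 0 :: 'k h_alg) \<mu> = h.span (h_eigengens \<mu>)"
proof (rule h.eigenspace_eqI[where S = "{1, 0, 2, 3}"])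
  fix x :: "'k h_alg"
  obtain w1 w0 w2 w3 where w: "w1 \<in> h.span (h_eigengens 1)" "w0 \<in> h.span (h_eigengens 0)"
    "w2 \<in> h.span (h_eigengens 2)" "w3 \<in> h.span (h_eigengens 3)" "x = w1 + (w0 + (w2 + w3))"
    by (rule h_eigen_decomposition)
  define w where "w \<kappa> = (if \<kappa> = 1 then w1 else if \<kappa> = 0 then w0 else if \<kappa> = 2 then w2 else w3)" for \<kappa> :: 'k
  have "(\<forall>\<kappa>\<in>{1, 0, 2, 3}. w \<kappa> \<in> h.span (h_eigengens \<kappa>)) \<and> x = (\<Sum>\<kappa>\<in>{1, 0, 2, 3}. w \<kappa>)"
    using w by (simp add: w_def char5_eigenvalues)
  then show "\<exists>w. (\<forall>\<kappa>\<in>{1, 0, 2, 3}. w \<kappa> \<in> h.span (h_eigengens \<kappa>)) \<and> x = (\<Sum>\<kappa>\<in>{1, 0, 2, 3}. w \<kappa>)"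
    by blast
next
  fix \<kappa> :: 'k
  assume "\<kappa> \<in> {1, 0, 2, 3}"
  then show "h.span (h_eigengens \<kappa>) \<subseteq> h.eigenspace (ha 0 :: 'k h_alg) \<kappa>"
    by (rule h.span_minimal[OF h_eigengens_subset h.subspace_eigenspace])
qed (use assms in simp_all)

lemmas h_eigenspaces = h_eigenspace_eq[of 1, simplified] h_eigenspace_eq[of 0, simplified]
  h_eigenspace_eq[of 2, simplified] h_eigenspace_eq[of 3, simplified]

section \<open>Eigenspaces and the reflection that fixes the axis\<close>

lemma h_flip_plus:
  assumes "x \<in> h.eigenspace (ha 0 :: 'k h_alg) \<mu>" "\<mu> \<in> {1, 0, 2}"
  shows "h_flip 0 x = x"
proof -
  have "h_eigengens \<mu> \<subseteq> {x :: 'k h_alg. h_flip 0 x = x}"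
    using assms(2)
    by (auto simp: h_eigengens_def char5_eigenvalues hu_def hv_def hZ_def hA_def h_flip.add
        h_flip.diff h_flip.scale h_flip_ha h_flip_hsz numerals_mod3 add.commute)
  moreover have "h.subspace {x :: 'k h_alg. h_flip 0 x = x}"
    by (intro h.subspaceI CollectI) (simp_all add: h_flip.zero h_flip.add h_flip.scale)
  ultimately have "h.span (h_eigengens \<mu>) \<subseteq> {x :: 'k h_alg. h_flip 0 x = x}"
    by (rule h.span_minimal)
  with assms h_eigenspace_eq[of \<mu>] show ?thesis by auto
qed

lemma h_flip_minus:
  assumes "x \<in> h.eigenspace (ha 0 :: 'k h_alg) 3"
  shows "h_flip 0 x = - x"
proof -
  have "h_eigengens 3 \<subseteq> {x :: 'k h_alg. h_flip 0 x = - x}"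
    by (auto simp: h_eigengens_def char5_eigenvalues h_flip.diff h_flip_ha h_flip_hsz numerals_mod3)
  moreover have "h.subspace {x :: 'k h_alg. h_flip 0 x = - x}"
    by (intro h.subspaceI CollectI) (simp_all add: h_flip.zero h_flip.add h_flip.scale)
  ultimately have "h.span (h_eigengens 3) \<subseteq> {x :: 'k h_alg. h_flip 0 x = - x}"
    by (rule h.span_minimal)
  with assms h_eigenspaces(4) show ?thesis by auto
qed

lemma double_eq_zeroD: "x = 0" if "x + x = (0 :: 'k h_alg)"
proof (rule poly_mapping_eqI)
  fix b
  have "2 * Poly_Mapping.lookup x b = 0"
    using arg_cong[OF that, of "\<lambda>y. Poly_Mapping.lookup y b"] by (simp add: lookup_linear)
  then show "Poly_Mapping.lookup x b = Poly_Mapping.lookup 0 b"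
    using char5_neqs(1) by simp
qed

text \<open>The reflection changes only the sign of \<open>w3\<close>; comparing \<open>x\<close>
  with its image therefore separates \<open>w3\<close> from the rest.\<close>

lemma h_eigenspace_decomposition:
  obtains w1 w0 w2 w3 where "w1 \<in> h.eigenspace (ha 0) 1" "w0 \<in> h.eigenspace (ha 0) 0"
    "w2 \<in> h.eigenspace (ha 0) 2" "w3 \<in> h.eigenspace (ha 0) 3"
    "x = w1 + w0 + w2 + (w3 :: 'k h_alg)" "h_flip 0 x = w1 + w0 + w2 - w3"
proof -
  obtain w1 w0 w2 w3 where w: "w1 \<in> h.eigenspace (ha 0) 1" "w0 \<in> h.eigenspace (ha 0) 0"
    "w2 \<in> h.eigenspace (ha 0) 2" "w3 \<in> h.eigenspace (ha 0) 3"
    and x: "x = w1 + w0 + w2 + w3"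
    using h_eigen_decomposition[of x] unfolding h_eigenspaces add.assoc by metis
  moreover have "h_flip 0 x = w1 + w0 + w2 - w3"
    unfolding x by (simp add: h_flip.add h_flip_plus[OF w(1)] h_flip_plus[OF w(2)]
        h_flip_plus[OF w(3)] h_flip_minus[OF w(4)])
  ultimately show thesis using that by blast
qed

lemma h_flip_fixed_in_eigensum:
  assumes "h_flip 0 x = x"
  shows "x \<in> h.eigensum (ha 0 :: 'k h_alg) {1, 0, 2}"
proof -
  obtain w1 w0 w2 w3 where w: "w1 \<in> h.eigenspace (ha 0) 1" "w0 \<in> h.eigenspace (ha 0) 0"
    "w2 \<in> h.eigenspace (ha 0) 2" "w3 \<in> h.eigenspace (ha 0) 3"
    and x: "x = w1 + w0 + w2 + w3" "h_flip 0 x = w1 + w0 + w2 - w3"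
    by (rule h_eigenspace_decomposition)
  then have "w3 + w3 = 0" using assms by (simp add: algebra_simps)
  from double_eq_zeroD[OF this] have "x = w1 + w0 + w2" using x(1) by simp
  moreover have "w1 \<in> h.eigensum (ha 0) {1, 0, 2}" "w0 \<in> h.eigensum (ha 0) {1, 0, 2}"
    "w2 \<in> h.eigensum (ha 0) {1, 0, 2}"
    using w h.eigenspace_subset_eigensum[of "{1, 0, 2 :: 'k}"] by blast+
  ultimately show ?thesis
    by (simp add: h.subspace_add h.subspace_eigensum)
qed

lemma h_flip_negated_in_eigenspace:
  assumes "h_flip 0 x = - x"
  shows "x \<in> h.eigenspace (ha 0 :: 'k h_alg) 3"
proof -
  obtain w1 w0 w2 w3 where w: "w1 \<in> h.eigenspace (ha 0) 1" "w0 \<in> h.eigenspace (ha 0) 0"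
    "w2 \<in> h.eigenspace (ha 0) 2" "w3 \<in> h.eigenspace (ha 0) 3"
    and x: "x = w1 + w0 + w2 + w3" "h_flip 0 x = w1 + w0 + w2 - w3"
    by (rule h_eigenspace_decomposition)
  then have "(w1 + w0 + w2) + (w1 + w0 + w2) = 0" using assms by (simp add: algebra_simps)
  from double_eq_zeroD[OF this] have "x = w3" using x(1) by simp
  with w(4) show ?thesis by simp
qed

section \<open>The fusion law\<close>

lemma h_mult_0_0:
  assumes "x \<in> h.eigenspace (ha 0 :: 'k h_alg) 0" "y \<in> h.eigenspace (ha 0) 0"
  shows "x \<cdot>\<^sub>h y \<in> h.eigenspace (ha 0) 0"
proof -
  let ?E = "h.span (h_eigengens 0) :: 'k h_alg set"
  have mem: "hu j \<in> ?E" "hZ j \<in> ?E" for j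
    by (rule h.span_base, simp add: h_eigengens_def)+
  \<comment> \<open>Unless 3 divides both indices, one of the factors is 0.\<close>
  have "hZ i \<cdot>\<^sub>h hZ j \<in> ?E" for i j
    by (cases "3 dvd i \<and> 3 dvd j")
      (auto simp: hZ_mult_hZ hZ_nondvd h.span_zero intro!: h.span_scale h.span_diff h.span_add mem)
  moreover have "hu i \<cdot>\<^sub>h hu j \<in> ?E" for i j
    unfolding hu_mult_hu by (intro h.span_scale h.span_diff h.span_add mem)
  moreover have uZ: "hu i \<cdot>\<^sub>h hZ j \<in> ?E" for i j
    unfolding hu_mult_hZ by (intro h.span_scale mem)
  moreover have "hZ j \<cdot>\<^sub>h hu i \<in> ?E" for i j
    using uZ by (simp only: h.mult_commute)
  ultimately have gens: "a \<cdot>\<^sub>h b \<in> ?E" if "a \<in> h_eigengens 0" "b \<in> h_eigengens 0" for a b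
    using that by (auto simp: h_eigengens_def)
  from gens assms[unfolded h_eigenspaces] show ?thesis
    unfolding h_eigenspaces by (rule h.span_mult_induct[OF h.subspace_span])
qed

lemma h_mult_0_2:
  assumes "x \<in> h.eigenspace (ha 0 :: 'k h_alg) 0" "y \<in> h.eigenspace (ha 0) 2"
  shows "x \<cdot>\<^sub>h y \<in> h.eigenspace (ha 0) 2"
proof -
  let ?E = "h.span (h_eigengens 2) :: 'k h_alg set"
  have mem: "hv j \<in> ?E" for j
    by (rule h.span_base, simp add: h_eigengens_def char5_eigenvalues)
  have "hu i \<cdot>\<^sub>h hv j \<in> ?E" for i j
    unfolding hu_mult_hv by (intro h.span_scale h.span_diff h.span_add mem)
  moreover have "hZ j \<cdot>\<^sub>h hv i \<in> ?E" for i j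
    by (simp add: h.mult_commute[of "hZ j"] hv_mult_hZ h.span_zero)
  ultimately have gens: "a \<cdot>\<^sub>h b \<in> ?E" if "a \<in> h_eigengens 0" "b \<in> h_eigengens 2" for a b
    using that by (auto simp: h_eigengens_def char5_eigenvalues)
  from gens assms[unfolded h_eigenspaces] show ?thesis
    unfolding h_eigenspaces by (rule h.span_mult_induct[OF h.subspace_span])
qed

lemma h_mult_2_2:
  assumes "x \<in> h.eigenspace (ha 0 :: 'k h_alg) 2" "y \<in> h.eigenspace (ha 0) 2"
  shows "x \<cdot>\<^sub>h y \<in> h.eigenspace (ha 0) 0"
proof -
  let ?E = "h.span (h_eigengens 0) :: 'k h_alg set"
  have mem: "hu j \<in> ?E" "hZ j \<in> ?E" for j
    by (rule h.span_base, simp add: h_eigengens_def)+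
  have "hv i \<cdot>\<^sub>h hv j \<in> ?E" for i j
    unfolding hv_mult_hv by (intro h.span_scale h.span_diff h.span_add h.span_neg mem)
  then have gens: "a \<cdot>\<^sub>h b \<in> ?E" if "a \<in> h_eigengens 2" "b \<in> h_eigengens 2" for a b
    using that by (auto simp: h_eigengens_def char5_eigenvalues)
  from gens assms[unfolded h_eigenspaces] show ?thesis
    unfolding h_eigenspaces by (rule h.span_mult_induct[OF h.subspace_span])
qed

lemma h_eigenspace_1: "h.eigenspace (ha 0 :: 'k h_alg) 1 = h.span {ha 0}"
  by (simp add: h_eigenspaces h_eigengens_def)

text \<open>By primitivity \<open>x\<close> is a multiple of \<open>ha 0\<close>, which acts on
  \<open>y\<close> as the scalar \<open>\<mu>\<close>.\<close>

lemma h_mult_1: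
  assumes "x \<in> h.eigenspace (ha 0 :: 'k h_alg) 1" "y \<in> h.eigenspace (ha 0) \<mu>"
  shows "x \<cdot>\<^sub>h y \<in> h.eigenspace (ha 0) \<mu>" "\<mu> = 0 \<Longrightarrow> x \<cdot>\<^sub>h y = 0"
proof -
  obtain c where "x = c *\<^sub>h ha 0"
    using assms(1) unfolding h_eigenspace_1 by (auto simp: h.span_singleton)
  then have "x \<cdot>\<^sub>h y = c *\<^sub>h \<mu> *\<^sub>h y"
    using assms(2) by (simp add: h.mult_scale_left h.eigenspace_def del: h.scale_scale)
  then show "x \<cdot>\<^sub>h y \<in> h.eigenspace (ha 0) \<mu>" "\<mu> = 0 \<Longrightarrow> x \<cdot>\<^sub>h y = 0"
    using assms(2) by (simp_all add: h.subspace_scale[OF h.subspace_eigenspace] del: h.scale_scale)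
qed

lemma monster_law_char5:
  "monster_law 2 (3 :: 'k) 1 1 = {1}" "monster_law 2 (3 :: 'k) 1 0 = {}"
  "monster_law 2 (3 :: 'k) 1 2 = {2}" "monster_law 2 (3 :: 'k) 1 3 = {3}"
  "monster_law 2 (3 :: 'k) 0 0 = {0}" "monster_law 2 (3 :: 'k) 0 2 = {2}"
  "monster_law 2 (3 :: 'k) 0 3 = {3}" "monster_law 2 (3 :: 'k) 2 2 = {1, 0}"
  "monster_law 2 (3 :: 'k) 2 3 = {3}" "monster_law 2 (3 :: 'k) 3 3 = {1, 0, 2}"
  by (simp_all add: monster_law_def doubleton_eq_iff singleton_insert_inj_eq char5_eigenvalues)

lemma monster_law_commute: "monster_law \<alpha> \<beta> \<mu> \<nu> = monster_law \<alpha> \<beta> \<nu> \<mu>"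
  unfolding monster_law_def insert_commute[of \<mu> \<nu>] ..

lemma h_fusion:
  assumes "\<mu> \<in> {1, 0, 2, 3}" "\<nu> \<in> {1, 0, 2, 3}"
    and "x \<in> h.eigenspace (ha 0 :: 'k h_alg) \<mu>" "y \<in> h.eigenspace (ha 0) \<nu>"
  shows "x \<cdot>\<^sub>h y \<in> h.eigensum (ha 0) (monster_law 2 3 \<mu> \<nu>)"
proof -
  \<comment> \<open>\<open>F\<close> is symmetric, so ten of the sixteen pairs of eigenvalues
    suffice.\<close>
  define F where "F \<mu> \<nu> \<longleftrightarrow> (\<forall>x \<in> h.eigenspace (ha 0 :: 'k h_alg) \<mu>. \<forall>y \<in> h.eigenspace (ha 0) \<nu>.
    x \<cdot>\<^sub>h y \<in> h.eigensum (ha 0) (monster_law 2 3 \<mu> \<nu>))" for \<mu> \<nu> :: 'k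
  have sym: "F \<nu> \<mu>" if "F \<mu> \<nu>" for \<mu> \<nu>
    using that unfolding F_def by (metis h.mult_commute monster_law_commute)
  have "F 1 1" "F 1 0" "F 1 2" "F 1 3"
    unfolding F_def monster_law_char5
    by (simp_all add: h_mult_1)
  moreover have "F 0 0" "F 0 2"
    unfolding F_def monster_law_char5 by (simp_all add: h_mult_0_0 h_mult_0_2)
  moreover have "F 2 2"
    unfolding F_def monster_law_char5
    using h_mult_2_2 h.eigenspace_subset_eigensum[of "{1, 0 :: 'k}" 0] by blast
  \<comment> \<open>The reflection negates the product of a fixed and a negated vector, so this
    product has eigenvalue 3.\<close>
  moreover have "F 0 3" "F 2 3"
    unfolding F_def monster_law_char5
    by (auto intro!: h_flip_negated_in_eigenspace
        simp: h_flip_mult h_flip_plus h_flip_minus h.mult_minus_right)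
  \<comment> \<open>Two negated vectors have a fixed product, hence one without a component for
    3.\<close>
  moreover have "F 3 3"
    unfolding F_def monster_law_char5
    by (auto intro!: h_flip_fixed_in_eigensum
        simp: h_flip_mult h_flip_minus h.mult_minus_left h.mult_minus_right)
  ultimately have "F \<mu> \<nu>"
    using assms(1,2) sym by blast
  with assms(3,4) show ?thesis unfolding F_def by blast
qed

lemma primitive_monster_axis_ha_0: "h.primitive_monster_axis 2 3 (ha 0 :: 'k h_alg)"
proof -
  have "Poly_Mapping.lookup (ha 0 :: 'k h_alg) (Ax 0) = 1" by (simp add: ha_def)
  then have "(ha 0 :: 'k h_alg) \<noteq> 0" by auto
  moreover have "x \<in> h.eigensum (ha 0) {1, 0, 2, 3}" for x :: "'k h_alg"
  proof -
    obtain w1 w0 w2 w3 where w: "w1 \<in> h.eigenspace (ha 0) 1" "w0 \<in> h.eigenspace (ha 0) 0"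
      "w2 \<in> h.eigenspace (ha 0) 2" "w3 \<in> h.eigenspace (ha 0) 3" "x = w1 + w0 + w2 + w3"
      by (rule h_eigenspace_decomposition)
    have "w1 \<in> h.eigensum (ha 0) {1, 0, 2, 3}" "w0 \<in> h.eigensum (ha 0) {1, 0, 2, 3}"
      "w2 \<in> h.eigensum (ha 0) {1, 0, 2, 3}" "w3 \<in> h.eigensum (ha 0) {1, 0, 2, 3}"
      using w(1-4) h.eigenspace_subset_eigensum[of "{1, 0, 2, 3 :: 'k}"] by blast+
    then show ?thesis
      by (simp add: w(5) h.subspace_add h.subspace_eigensum)
  qed
  ultimately show ?thesis
    unfolding h.primitive_monster_axis_def
    using h_fusion by (auto simp: ha_mult_ha_0 h.eigensum_direct h_eigenspace_1)
qed

end

section \<open>Generation by the two axes\<close>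

text \<open>The product of \<open>ha 0\<close> and \<open>ha 1\<close> yields
  \<open>hsz 0 1\<close>, and multiplying \<open>ha i\<close> by it yields
  \<open>ha (i - 1) + ha (i + 1)\<close> up to known terms. So all \<open>ha i\<close> arise step by
  step, and their products give every \<open>hsz r j\<close>.\<close>

lemma subalgebra_hull_ha: "h.subalgebra hull {ha 0, ha 1} = (UNIV :: 'k::field h_alg set)"
proof -
  have "x \<in> W" if W: "h.subalgebra W" "{ha 0, ha 1} \<subseteq> W" for x :: "'k h_alg" and W
  proof -
    have mult: "x \<cdot>\<^sub>h y \<in> W" if "x \<in> W" "y \<in> W" for x y
      using W(1) that by (auto simp: h.subalgebra_def)
    have sub: "h.subspace W" using W(1) by (auto simp: h.subalgebra_def)
    note closed = h.subspace_add[OF sub] h.subspace_diff[OF sub] h.subspace_scale[OF sub]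
    have s: "hsz (of_int i) (i - j) \<in> W" if "ha i \<in> W" "ha j \<in> W" for i j
    proof -
      have "hsz (of_int i) (i - j) = ha i \<cdot>\<^sub>h ha j - (-2) *\<^sub>h (ha i + ha j)"
        by (simp add: ha_ha)
      also have "\<dots> \<in> W" using that by (intro closed mult)
      finally show ?thesis .
    qed
    have "ha 0 \<in> W" "ha 1 \<in> W" using W(2) by auto
    from s[OF this] have "hsz 0 1 \<in> W" by simp
    \<comment> \<open>Index 1 is not divisible by 3, so one element serves for all classes.\<close>
    moreover have "hsz r 1 = (hsz 0 1 :: 'k h_alg)" for r by (rule hsz_nondvd) simp
    ultimately have s1: "hsz r 1 \<in> W" for r by metis
    have step: "ha (i - 1) + ha (i + 1) \<in> W" if "ha i \<in> W" for i
    proof -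
      have "ha (i - 1) + ha (i + 1) = ha i \<cdot>\<^sub>h hsz 0 1 - (-2) *\<^sub>h ha i
          + (hsz (of_int i) 1 + hsz 0 1 - hsz (- of_int i - 0) 1)"
        unfolding ha_hsz hp_def by simp
      also have "\<dots> \<in> W" using that by (intro closed mult s1)
      finally show ?thesis .
    qed
    \<comment> \<open>Each step needs two neighbouring vectors, so the induction carries a
      pair.\<close>
    have nat: "ha (int n) \<in> W \<and> ha (int n + 1) \<in> W" for n
    proof (induction n)
      case (Suc n)
      have "ha (int (Suc n) + 1) = (ha (int n) + ha (int n + 2)) - ha (int n)"
        by (simp add: add.commute)
      also have "\<dots> \<in> W" 
        using Suc step[of "int n + 1"] by (intro h.subspace_diff[OF sub]) (simp_all add: add.commute)
      finally show ?case using Suc by (simp add: add.commute)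
    qed (use \<open>ha 0 \<in> W\<close> \<open>ha 1 \<in> W\<close> in simp)
    have neg: "ha (- int n) \<in> W \<and> ha (1 - int n) \<in> W" for n
    proof (induction n)
      case (Suc n)
      have "- int (Suc n) = - int n - 1" "- int n + 1 = 1 - int n" by simp_all
      then have "ha (- int (Suc n)) = (ha (- int n - 1) + ha (- int n + 1)) - ha (1 - int n)"
        by (simp only: add_diff_cancel_right')
      also have "\<dots> \<in> W" 
        using Suc step[of "- int n"] by (intro h.subspace_diff[OF sub]) (simp_all add: add.commute)
      finally show ?case using Suc by simp
    qed (use \<open>ha 0 \<in> W\<close> \<open>ha 1 \<in> W\<close> in simp)
    have a: "ha i \<in> W" for i
      using nat[of "nat i"] neg[of "nat (- i)"] by (cases "0 \<le> i") simp_all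
    have "hsz r j \<in> W" for r j
    proof -
      \<comment> \<open>\<open>hsz r j\<close> occurs in the product of \<open>ha r\<close> and
        \<open>ha (r - j)\<close>, with \<open>r\<close> taken as the integer 0, 1 or 2.\<close>
      have "hsz 0 j \<in> W" "hsz 1 j \<in> W" "hsz 2 j \<in> W"
        using s[OF a a, of 0 "- j"] s[OF a a, of 1 "1 - j"] s[OF a a, of 2 "2 - j"] by simp_all
      then show ?thesis by (cases r rule: cases_mod3) simp_all
    qed
    with a have "h_gens \<subseteq> W" unfolding h_gens_def by blast
    then have "h.span h_gens \<subseteq> W" using sub by (rule h.span_minimal)
    then show ?thesis unfolding span_h_gens by blast
  qed
  then show ?thesis unfolding hull_def by blast
qed

theorem theorem6:
  assumes "CHAR('k::field) = 5"
  shows "symmetric_two_generated_monster_algebra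
           (h_scale :: 'k \<Rightarrow> 'k h_alg \<Rightarrow> 'k h_alg) h_mult 2 (1/2) (ha 0) (ha 1)"
proof -
  have five: "(5 :: 'k) = 0"
    using of_nat_CHAR[where 'a = 'k] assms by simp
  note axis = primitive_monster_axis_ha_0[OF five]
  have flip: "h_flip 1 (ha 0) = (ha 1 :: 'k h_alg)" "h_flip 1 (ha 1) = (ha 0 :: 'k h_alg)"
    by (simp_all add: h_flip_ha)
  have "h.primitive_monster_axis 2 3 (ha 1 :: 'k h_alg)"
    using h.automorphism_primitive_monster_axis[OF automorphism_h_flip axis, of 1] by (simp add: flip)
  with axis show ?thesis
    unfolding half_eq_three[OF five]
    by unfold_locales
      (use char5_eigenvalues[OF five] flip automorphism_h_flip in
        \<open>auto simp: subalgebra_hull_ha intro!: exI[of _ "h_flip 1"]\<close>)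
qed

end
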